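(* Let $C\geq1$ be an absolute constant such that for all $n,d$ and every $g\colon\{-1,1\}^n\to\{-1,0,1\}$, $g\not\equiv0$, computable by a depth-$d$ decision tree, with $q=\Pr_x[g(x)\ne0]$, one has $\|L_1g\|\le\binom d1^{1/2}Cq\sqrt{\ln(e/q)}$ and $\|L_2g\|\le\binom d2^{1/2}C^2q\sqrt{\ln(e/q)}\sqrt{\ln(en/q)}$. Let $n,d\ge1$ be integers, $0\le p\le1$, and $T\in\mathcal T^*(n,d,p,0)$. Let $\ell\ge1$, let $I_1,\dots,I_\ell$ be pairwise disjoint integer intervals with $I_1\cup\dots\cup I_\ell=\{1,\dots,d\}$, let $k_1,\dots,k_\ell\in\{1,2\}$ and $k=k_1+\dots+k_\ell$. Then \[ \left\|T|_{\binom{I_1}{k_1}*\binom{I_2}{k_2}*\cdots*\binom{I_\ell}{k_\ell}}\right\|\le 2C^k\,12^{\ell-1}\Lambda_{n^2,k}(p)\prod_{i=1}^\ell\binom{|I_i|}{k_i}^{1/2}. \]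
   Context: Decision trees: a decision tree of depth $d$ in variables $x_1,\dots,x_n\in\{-1,1\}$ is a function $T$ on strings $v\in\{-1,1\}^{\le d}$ (the empty string is the root) such that for $|v|\le d-1$, $T(v)\in\{1,\dots,n\}$ is the index of the variable queried at node $v$, with $T(\varepsilon),T(v_1),\dots,T(v_1\cdots v_{d-1})$ pairwise distinct for each $v\in\{-1,1\}^{d-1}$; and for each leaf $v\in\{-1,1\}^d$, $T(v)$ is a real multilinear polynomial in $x_1,\dots,x_n$ not involving $x_{T(\varepsilon)},\dots,x_{T(v_1\cdots v_{d-1})}$. The density of $T$ is the fraction of leaves $v$ with $T(v)\ne0$. $\mathcal T^*(n,d,p,0)$ is the set of depth-$d$ trees in $n$ variables with density $p$ whose leaf labels all lie in $\{-1,0,1\}$. For a family $\mathcal S$ of subsets of $\{1,\dots,d\}$, $T|_{\mathcal S}\colon\{-1,1\}^n\to\mathbb R$ is $T|_{\mathcal S}(x)=\sum_{S\in\mathcal S}\sum_{v\in\{-1,1\}^d}T(v)\,2^{-d}\prod_{i\in S}v_ix_{T(v_1v_2\cdots v_{i-1})}$. For $\phi\colon\{-1,1\}^n\to\mathbb R$, $\|\phi\|$ is the sum of absolute values of its Fourier coefficients, and $L_k\phi$ its degree-$k$ homogeneous Fourier part. An integer interval is a finite set of consecutive integers; $\binom Ij$ is the family of $j$-subsets of $I$; $\mathcal A*\mathcal B=\{A\cup B:A\in\mathcal A,B\in\mathcal B\}$. For positive integers $m,k$: $\Lambda_{m,k}(0)=0$; $\Lambda_{m,k}(p)=p\sqrt{(\frac1k\ln\frac{e^km^{k-1}}p)^k}$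 for $0<p\le1/m$; $\Lambda_{m,k}(p)=p\sqrt{\ln\frac ep(\ln em)^{k-1}}$ for $1/m<p\le1$. *)

theory Defs
  imports Complex_Main "HOL-Library.FuncSet" "HOL-Library.Ramsey" "HOL-Library.Disjoint_Sets" "HOL-Library.Poly_Mapping"
begin

definition cube :: "nat \<Rightarrow> (nat \<Rightarrow> real) set" where
  "cube n = {1..n} \<rightarrow>\<^sub>E {-1, 1}"

subsection \<open>Fourier analysis on the cube\<close>

definition fourier_coeff :: "nat \<Rightarrow> ((nat \<Rightarrow> real) \<Rightarrow> real) \<Rightarrow> nat set \<Rightarrow> real" where
  "fourier_coeff n \<phi> S = (\<Sum>x\<in>cube n. \<phi> x * (\<Prod>i\<in>S. x i)) / 2 ^ n"

definition fourier_norm :: "nat \<Rightarrow> ((nat \<Rightarrow> real) \<Rightarrow> real) \<Rightarrow> real" where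
  "fourier_norm n \<phi> = (\<Sum>S\<in>Pow {1..n}. \<bar>fourier_coeff n \<phi> S\<bar>)"

definition fourier_level ::
    "nat \<Rightarrow> nat \<Rightarrow> ((nat \<Rightarrow> real) \<Rightarrow> real) \<Rightarrow> (nat \<Rightarrow> real) \<Rightarrow> real" where
  "fourier_level n k \<phi> x = (\<Sum>S\<in>nsets {1..n} k. fourier_coeff n \<phi> S * (\<Prod>i\<in>S. x i))"

definition nonzero_prob :: "nat \<Rightarrow> ((nat \<Rightarrow> real) \<Rightarrow> real) \<Rightarrow> real" where
  "nonzero_prob n g = real (card {x \<in> cube n. g x \<noteq> 0}) / real (card (cube n))"

subsection \<open>Decision trees\<close>

text \<open>A real multilinear polynomial is given by its coefficients: the coefficient at a set S
  belongs to the monomial that is the product of the variables with index in S.\<close>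

type_synonym mlpoly = "nat set \<Rightarrow>\<^sub>0 real"

definition ml_const :: "real \<Rightarrow> mlpoly" where
  "ml_const c = Poly_Mapping.single {} c"

definition ml_eval :: "mlpoly \<Rightarrow> (nat \<Rightarrow> real) \<Rightarrow> real" where
  "ml_eval P x = (\<Sum>S\<in>Poly_Mapping.keys P. Poly_Mapping.lookup P S * (\<Prod>i\<in>S. x i))"

definition strings :: "nat \<Rightarrow> real list set" where
  "strings d = {v. length v = d \<and> set v \<subseteq> {-1, 1}}"

text \<open>A tree is a function on strings; its values at internal nodes (strings of length less than
  the depth) and at leaves (strings of length equal to the depth) have different types and are
  kept in two fields. The depth is passed separately, and values at other strings are
  irrelevant. List positions start at 0, so the i-th entry (from 1) of v is \<open>v ! (i - 1)\<close>, and the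
  node at which the i-th query is made is \<open>take (i - 1) v\<close>.\<close>

record dtree =
  query :: "real list \<Rightarrow> nat"
  leaf :: "real list \<Rightarrow> mlpoly"

definition queried :: "dtree \<Rightarrow> real list \<Rightarrow> nat \<Rightarrow> nat" where
  "queried T v i = query T (take (i - 1) v)"

definition is_dtree :: "nat \<Rightarrow> nat \<Rightarrow> dtree \<Rightarrow> bool" where
  "is_dtree n d T \<longleftrightarrow>
     (\<forall>j<d. \<forall>v\<in>strings j. query T v \<in> {1..n}) \<and>
     (\<forall>v\<in>strings d. inj_on (queried T v) {1..d}) \<and>
     (\<forall>v\<in>strings d. Poly_Mapping.keys (leaf T v) \<subseteq> Pow ({1..n} - queried T v ` {1..d}))"

definition density :: "nat \<Rightarrow> dtree \<Rightarrow> real" where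
  "density d T = real (card {v \<in> strings d. leaf T v \<noteq> 0}) / 2 ^ d"

text \<open>The class \<open>T*(n, d, p, 0)\<close>; only the last parameter 0 is needed.\<close>

definition trees_star0 :: "nat \<Rightarrow> nat \<Rightarrow> real \<Rightarrow> dtree set" where
  "trees_star0 n d p =
     {T. is_dtree n d T \<and> density d T = p \<and> (\<forall>v\<in>strings d. leaf T v \<in> ml_const ` {-1, 0, 1})}"

primrec path :: "dtree \<Rightarrow> (nat \<Rightarrow> real) \<Rightarrow> nat \<Rightarrow> real list" where
  "path T x 0 = []"
| "path T x (Suc j) = path T x j @ [x (query T (path T x j))]"

text \<open>Computability refers to trees with constant leaf labels; with arbitrary polynomial labels
  every function would be computable in depth 0.\<close>

definition computable :: "nat \<Rightarrow> nat \<Rightarrow> ((nat \<Rightarrow> real) \<Rightarrow> real) \<Rightarrow> bool" where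
  "computable n d g \<longleftrightarrow>
     (\<exists>T. is_dtree n d T \<and> (\<forall>v\<in>strings d. leaf T v \<in> range ml_const) \<and>
          (\<forall>x\<in>cube n. g x = ml_eval (leaf T (path T x d)) x))"

definition tree_part :: "dtree \<Rightarrow> nat \<Rightarrow> nat set set \<Rightarrow> (nat \<Rightarrow> real) \<Rightarrow> real" where
  "tree_part T d \<S> x =
     (\<Sum>S\<in>\<S>. \<Sum>v\<in>strings d.
        ml_eval (leaf T v) x / 2 ^ d * (\<Prod>i\<in>S. v ! (i - 1) * x (queried T v i)))"

subsection \<open>Intervals and families of sets\<close>

definition is_interval_nat :: "nat set \<Rightarrow> bool" where
  "is_interval_nat A \<longleftrightarrow> (\<exists>a b. A = {a..b})"

definition fam_join :: "nat set set \<Rightarrow> nat set set \<Rightarrow> nat set set" where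
  "fam_join \<A> \<B> = {A \<union> B | A B. A \<in> \<A> \<and> B \<in> \<B>}"

text \<open>The iterated join of the families with indices from 1 to l; the family \<open>{{}}\<close> is the neutral
  element of the join.\<close>

primrec fam_joins :: "(nat \<Rightarrow> nat set set) \<Rightarrow> nat \<Rightarrow> nat set set" where
  "fam_joins \<F> 0 = {{}}"
| "fam_joins \<F> (Suc l) = fam_join (fam_joins \<F> l) (\<F> (Suc l))"

definition Lam :: "nat \<Rightarrow> nat \<Rightarrow> real \<Rightarrow> real" where
  "Lam m k p =
     (if p = 0 then 0
      else if p \<le> 1 / real m
      then p * sqrt ((1 / real k * ln (exp (real k) * real m ^ (k - 1) / p)) ^ k)
      else p * sqrt (ln (exp 1 / p) * ln (exp 1 * real m) ^ (k - 1)))"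

text \<open>The property required of the absolute constant C, with n at least 1 so that the last
  logarithm is meaningful.\<close>

definition level12_const :: "real \<Rightarrow> bool" where
  "level12_const C \<longleftrightarrow>
     (\<forall>n\<ge>1. \<forall>d g. \<forall>q.
        (\<forall>x\<in>cube n. g x \<in> {-1, 0, 1}) \<and> (\<exists>x\<in>cube n. g x \<noteq> 0) \<and>
        computable n d g \<and> q = nonzero_prob n g \<longrightarrow>
          fourier_norm n (fourier_level n 1 g)
            \<le> sqrt (real (d choose 1)) * C * q * sqrt (ln (exp 1 / q)) \<and>
          fourier_norm n (fourier_level n 2 g)
            \<le> sqrt (real (d choose 2)) * C\<^sup>2 * q * sqrt (ln (exp 1 / q))
               * sqrt (ln (exp 1 * real n / q)))"

end

theory Submission
  imports Defs
begin

text \<open>The bound is proved by induction on the number of intervals, cutting off the last interval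
  \<open>I\<^sub>l\<close>. Below each node u at the depth where \<open>I\<^sub>l\<close> starts, the part of the subtree that belongs to
  \<open>I\<^sub>l\<close> is a homogeneous polynomial \<open>P\<^sub>u\<close> of degree \<open>k\<^sub>l\<close>, and its norm is bounded by the level inequality in terms
  of the density \<open>q\<^sub>u\<close> of the subtree. The nodes are grouped by the dyadic scale of \<open>q\<^sub>u\<close>. Within a
  group, convexity replaces each \<open>P\<^sub>u\<close> by a multiple of a signed monomial; sorting the nodes by this
  monomial gives at most \<open>n\<^sup>2\<close> shallower trees with leaves in \<open>{-1, 0, 1}\<close>, to which the induction
  hypothesis applies.

  What remains is to add up the bounds over monomials and scales. The functions involved have
  the shape \<open>q R(q)\<close> with \<open>R(q) \<le> R(p) (p/q)\<^sup>\<epsilon>\<close>, so that weighted AM-GM puts \<open>q R(q)\<close> below the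
  line \<open>R(p) ((1 - \<epsilon>) q + \<epsilon> p)\<close>, which serves as a tangent in all Jensen-type steps. For p at most
  \<open>1/n\<^sup>2\<close> the logarithmic factors of the two stages are combined by AM-GM; for larger p the factors coming
  from the induction hypothesis are essentially constant.\<close>

subsection \<open>Tangent inequalities for products with logarithms\<close>

text \<open>Raise \<open>1 + t <= exp t\<close> at \<open>t = (y' - y) / y\<close> to the power
  \<open>k / 2\<close>. The coefficient \<open>k / (2 * y)\<close> is the slope of
  \<open>(k / 2) * ln\<close> at \<open>y\<close>, so the bound is exact to first order.\<close>

lemma sqrt_power_le_exp:
  fixes y y' :: real
  assumes "0 < y" "0 \<le> y'"
  shows "sqrt (y' ^ k) \<le> sqrt (y ^ k) * exp (real k * (y' - y) / (2 * y))"
proof -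
  have "y' = y * (1 + (y' - y) / y)"
    using assms by (simp add: field_simps)
  also have "\<dots> \<le> y * exp ((y' - y) / y)"
    using assms by (intro mult_left_mono exp_ge_add_one_self) auto
  finally have "y' ^ k \<le> (y * exp ((y' - y) / y)) ^ k"
    using assms by (intro power_mono) auto
  also have "\<dots> = y ^ k * (exp (real k * (y' - y) / (2 * y)))\<^sup>2"
    using assms by (simp add: power_mult_distrib flip: exp_of_nat_mult exp_double)
  finally have "sqrt (y' ^ k) \<le> sqrt (y ^ k * (exp (real k * (y' - y) / (2 * y)))\<^sup>2)"
    by simp
  then show ?thesis
    by (simp add: real_sqrt_mult)
qed

text \<open>The hypothesis bounds \<open>q * R\<close> by \<open>R0\<close> times the weighted
  geometric mean of \<open>q\<close> and \<open>p\<close>, and weighted AM-GM makes this linear in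
  \<open>q\<close>.\<close>

lemma exp_tangent_le:
  fixes q p R R0 \<epsilon> :: real
  assumes "0 < q" "0 < p" "0 \<le> \<epsilon>" "\<epsilon> \<le> 1" "0 \<le> R0"
    and R: "R \<le> R0 * exp (\<epsilon> * (ln p - ln q))"
  shows "q * R \<le> R0 * ((1 - \<epsilon>) * q + \<epsilon> * p)"
proof -
  define z where "z = (1 - \<epsilon>) * q + \<epsilon> * p"
  have z: "z > 0"
    unfolding z_def using assms by (cases "\<epsilon> = 0") (auto intro: add_nonneg_pos)
  \<comment> \<open>\<open>ln\<close> lies below its tangent at the mean \<open>z\<close>; in the
    weighted sum of the two bounds the linear terms cancel.\<close>
  have a: "ln q \<le> ln z + (q / z - 1)" "ln p \<le> ln z + (p / z - 1)"
    using ln_le_minus_one[of "q / z"] ln_le_minus_one[of "p / z"] z assms by (auto simp: ln_div)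
  have "(1 - \<epsilon>) * ln q + \<epsilon> * ln p \<le> (1 - \<epsilon>) * (ln z + (q / z - 1)) + \<epsilon> * (ln z + (p / z - 1))"
    using a assms by (intro add_mono mult_left_mono) auto
  also have "\<dots> = ln z + ((1 - \<epsilon>) * q + \<epsilon> * p) / z - 1"
    using z by (simp add: field_simps)
  also have "\<dots> = ln z"
    using z by (simp flip: z_def)
  finally have *: "exp ((1 - \<epsilon>) * ln q + \<epsilon> * ln p) \<le> z"
    using z by (simp add: ln_ge_iff)
  have "q * exp (\<epsilon> * (ln p - ln q)) = exp (ln q + \<epsilon> * (ln p - ln q))"
    using assms by (simp add: exp_add)
  also have "\<dots> \<le> z"
    using * by (simp add: algebra_simps)
  finally have "R0 * (q * exp (\<epsilon> * (ln p - ln q))) \<le> R0 * z"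
    using assms by (intro mult_left_mono)
  moreover have "q * R \<le> q * (R0 * exp (\<epsilon> * (ln p - ln q)))"
    using R assms by (intro mult_left_mono) auto
  ultimately show ?thesis
    by (simp add: z_def ac_simps)
qed

text \<open>Divide both numbers by their mean \<open>Y\<close> and use
  \<open>t <= exp (t - 1)\<close>; by the choice of \<open>Y\<close> the exponents add up to
  0.\<close>

lemma weighted_am_gm:
  fixes W X :: real
  assumes "0 \<le> W" "0 \<le> X" "i + j > 0"
  shows "W ^ i * X ^ j \<le> ((real i * W + real j * X) / real (i + j)) ^ (i + j)"
proof -
  define Y where "Y = (real i * W + real j * X) / real (i + j)"
  have "Y \<ge> 0"
    using assms by (simp add: Y_def)
  show ?thesis
  proof (cases "Y = 0")
    case True
    \<comment> \<open>With mean 0, a factor with positive exponent has base 0, and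
      \<open>i + j > 0\<close> provides such a factor.\<close>
    then have "i = 0 \<or> W = 0" "j = 0 \<or> X = 0"
      using assms by (auto simp: Y_def add_nonneg_eq_0_iff)
    then show ?thesis
      using assms \<open>Y \<ge> 0\<close> unfolding Y_def[symmetric] by (auto simp: power_0_left)
  next
    case False
    with \<open>Y \<ge> 0\<close> have "Y > 0" by simp
    have "(W / Y) ^ i * (X / Y) ^ j \<le> exp (W / Y - 1) ^ i * exp (X / Y - 1) ^ j"
      using assms \<open>Y > 0\<close> exp_ge_add_one_self[of "W / Y - 1"] exp_ge_add_one_self[of "X / Y - 1"]
      by (intro mult_mono power_mono) auto
    also have "\<dots> = exp ((real i * W + real j * X) / Y - real (i + j))"
      by (simp flip: exp_of_nat_mult exp_add add: algebra_simps add_divide_distrib)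
    also have "(real i * W + real j * X) / Y = real (i + j)"
      using \<open>Y > 0\<close> assms by (simp add: Y_def field_simps)
    finally have "W ^ i * X ^ j / Y ^ (i + j) \<le> 1"
      by (simp add: power_divide power_add)
    then show ?thesis
      using \<open>Y > 0\<close> unfolding Y_def[symmetric] by (simp add: field_simps)
  qed
qed

text \<open>For \<open>L = k + (k - 1) ln m\<close> this is the factor next to \<open>p\<close> in
  the small-\<open>p\<close> branch of \<open>Lam m k p\<close>. \<open>L\<close> is a free
  parameter because the sum over monomials raises it by \<open>ln m\<close>.\<close>

definition log_pow :: "nat \<Rightarrow> real \<Rightarrow> real \<Rightarrow> real" where
  "log_pow k L q = sqrt (((L - ln q) / real k) ^ k)"

lemma log_pow_nonneg: "ln q \<le> L \<Longrightarrow> 0 \<le> log_pow k L q"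
  by (simp add: log_pow_def)

lemma log_pow_le_exp:
  assumes "k > 0" "ln q \<le> L" "ln p < L"
  shows "log_pow k L q \<le> log_pow k L p * exp (real k / (2 * (L - ln p)) * (ln p - ln q))"
proof -
  have *: "real k * ((L - ln q) / real k - (L - ln p) / real k) / (2 * ((L - ln p) / real k))
      = real k / (2 * (L - ln p)) * (ln p - ln q)"
    using assms by (simp add: field_simps)
  have "0 < (L - ln p) / real k" "0 \<le> (L - ln q) / real k"
    using assms by auto
  from sqrt_power_le_exp[OF this, of k] show ?thesis
    unfolding log_pow_def * .
qed

lemma log_pow_tangent:
  assumes "k > 0" "0 < p" "0 \<le> q" "q > 0 \<Longrightarrow> ln q \<le> L" "real k \<le> L - ln p"
    and \<epsilon>: "\<epsilon> = real k / (2 * (L - ln p))"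
  shows "q * log_pow k L q \<le> log_pow k L p * ((1 - \<epsilon>) * q + \<epsilon> * p)"
proof (cases "q = 0")
  case True
  have "0 \<le> \<epsilon>" "0 \<le> log_pow k L p"
    using assms by (auto intro!: log_pow_nonneg divide_nonneg_nonneg)
  then show ?thesis
    using True assms by simp
next
  case False
  have "L - ln p > 0" using assms by linarith
  moreover from this have "\<epsilon> \<le> 1" "\<epsilon> \<ge> 0"
    using assms by (auto simp: \<epsilon> divide_le_eq)
  ultimately show ?thesis
    using False assms unfolding \<epsilon>
    by (intro exp_tangent_le log_pow_le_exp log_pow_nonneg) auto
qed

lemma Lam_eq_small:
  assumes "0 < p" "p \<le> 1 / real m" "m \<ge> 1" "k \<ge> 1"
  shows "Lam m k p = p * log_pow k (real k + real (k - 1) * ln (real m)) p"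
proof -
  have "ln (exp (real k) * real m ^ (k - 1) / p) = real k + real (k - 1) * ln (real m) - ln p"
    using assms by (simp add: ln_mult ln_div ln_realpow)
  then show ?thesis
    using assms by (simp add: Lam_def log_pow_def)
qed

text \<open>Above \<open>1 / m\<close> this is AM-GM for one factor \<open>1 - ln p\<close> and
  \<open>k - 1\<close> factors \<open>1 + ln m\<close>, whose mean is the base of the power in
  \<open>log_pow\<close>. One formula thus dominates both branches of \<open>Lam\<close>.\<close>

lemma Lam_le_log_pow:
  assumes "0 < p" "p \<le> 1" "m \<ge> 1" "k \<ge> 1"
  shows "Lam m k p \<le> p * log_pow k (real k + real (k - 1) * ln (real m)) p"
proof (cases "p \<le> 1 / real m")
  case True
  then show ?thesis using Lam_eq_small assms by simp
next
  case False
  have "ln p \<le> 0" "ln (real m) \<ge> 0"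
    using assms by auto
  have "(1 - ln p) ^ 1 * (1 + ln (real m)) ^ (k - 1)
      \<le> ((real 1 * (1 - ln p) + real (k - 1) * (1 + ln (real m))) / real (1 + (k - 1))) ^ (1 + (k - 1))"
    using \<open>ln p \<le> 0\<close> \<open>ln (real m) \<ge> 0\<close> by (intro weighted_am_gm) auto
  also have "real 1 * (1 - ln p) + real (k - 1) * (1 + ln (real m))
      = real k + real (k - 1) * ln (real m) - ln p"
    using assms by (simp add: algebra_simps of_nat_diff)
  finally have "(1 - ln p) * (1 + ln (real m)) ^ (k - 1)
      \<le> ((real k + real (k - 1) * ln (real m) - ln p) / real k) ^ k"
    using assms by simp
  moreover have "ln (exp 1 / p) = 1 - ln p" "ln (exp 1 * real m) = 1 + ln (real m)"
    using assms by (auto simp: ln_mult ln_div)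
  ultimately show ?thesis
    using False assms by (simp add: Lam_def log_pow_def)
qed

lemma exp_half_le: "exp (1 / 2 :: real) \<le> 2"
proof -
  have "(exp (1 / 2 :: real))\<^sup>2 \<le> 2\<^sup>2"
    using exp_le by (simp flip: exp_double)
  then show ?thesis
    by (rule power2_le_imp_le) simp
qed

text \<open>The right-hand side of the level-k inequality without the power of C and the binomial coefficient;
  only \<open>k = 1\<close> and \<open>k = 2\<close> are meaningful. The value at 0 is the limit.\<close>

definition level_bound :: "nat \<Rightarrow> nat \<Rightarrow> real \<Rightarrow> real" where
  "level_bound n k q = (if q = 0 then 0 else if k = 1 then q * sqrt (1 - ln q)
     else q * sqrt ((1 - ln q) * (1 + ln (real n) - ln q)))"

lemma level_bound_nonneg: "\<lbrakk>n \<ge> 1; 0 \<le> q; q \<le> 1\<rbrakk> \<Longrightarrow> 0 \<le> level_bound n k q"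
  unfolding level_bound_def
  by (smt (verit) ln_le_zero_iff ln_ge_zero mult_nonneg_nonneg real_sqrt_ge_zero of_nat_1 of_nat_mono)

text \<open>Each square root of a logarithm contributes at most 1/2 to \<open>\<epsilon>\<close>, so
  even the two roots for \<open>k = 2\<close> leave a supporting line of nonnegative slope. Such
  lines stand in for monotonicity and concavity below.\<close>

lemma level_bound_tangent:
  assumes "n \<ge> 1" "0 < p" "p \<le> 1"
  shows "\<exists>R \<epsilon>. \<epsilon> \<le> 1 \<and> level_bound n k p = R * p \<and>
     (\<forall>q. 0 \<le> q \<and> q \<le> 1 \<longrightarrow> level_bound n k q \<le> R * ((1 - \<epsilon>) * q + \<epsilon> * p))"
proof -
  have p: "ln p \<le> 0" and n: "ln (real n) \<ge> 0"
    using assms by auto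
  \<comment> \<open>A single square root is \<open>log_pow\<close> with exponent 1 and
    \<open>L = a\<close>.\<close>
  have sq: "sqrt (a - ln q) \<le> sqrt (a - ln p) * exp (1 / (2 * (a - ln p)) * (ln p - ln q))"
    if "a \<ge> 1" "0 < q" "q \<le> 1" for a q
  proof -
    have "ln q \<le> 0" using that by simp
    then have "ln q \<le> a" "ln p < a" using that p by linarith+
    with log_pow_le_exp[of 1 q a p] show ?thesis by (simp add: log_pow_def)
  qed
  show ?thesis
  proof (cases "k = 1")
    case True
    define \<epsilon> where "\<epsilon> = 1 / (2 * (1 - ln p))"
    have \<epsilon>: "0 \<le> \<epsilon>" "\<epsilon> \<le> 1"
      using p by (auto simp: \<epsilon>_def divide_le_eq)
    show ?thesis
    proof (rule exI[of _ "sqrt (1 - ln p)"], rule exI[of _ \<epsilon>], intro conjI allI impI)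
      fix q :: real assume q: "0 \<le> q \<and> q \<le> 1"
      show "level_bound n k q \<le> sqrt (1 - ln p) * ((1 - \<epsilon>) * q + \<epsilon> * p)"
      proof (cases "q = 0")
        case False
        with q have "sqrt (1 - ln q) \<le> sqrt (1 - ln p) * exp (\<epsilon> * (ln p - ln q))"
          unfolding \<epsilon>_def by (intro sq) auto
        moreover have "0 \<le> sqrt (1 - ln p)"
          using p by simp
        ultimately have "q * sqrt (1 - ln q) \<le> sqrt (1 - ln p) * ((1 - \<epsilon>) * q + \<epsilon> * p)"
          using False q assms \<epsilon> by (intro exp_tangent_le) auto
        then show ?thesis
          using True False by (simp add: level_bound_def)
      next
        case q0: True
        have "0 \<le> sqrt (1 - ln p)"
          using p by simp
        with q0 True \<epsilon> assms show ?thesis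
          by (simp add: level_bound_def)
      qed
    qed (use True assms \<epsilon> in \<open>auto simp: level_bound_def\<close>)
  next
    case False
    \<comment> \<open>The exponents for the two square roots add up when the bounds are
      multiplied.\<close>
    define \<epsilon> where "\<epsilon> = 1 / (2 * (1 - ln p)) + 1 / (2 * (1 + ln (real n) - ln p))"
    have "1 / (2 * (1 - ln p)) \<le> 1 / 2" "1 / (2 * (1 + ln (real n) - ln p)) \<le> 1 / 2"
      using p n by (auto simp: divide_le_eq)
    moreover have "0 \<le> 1 / (2 * (1 - ln p))" "0 \<le> 1 / (2 * (1 + ln (real n) - ln p))"
      using p n by auto
    ultimately have \<epsilon>: "0 \<le> \<epsilon>" "\<epsilon> \<le> 1"
      unfolding \<epsilon>_def by linarith+
    define R where "R = sqrt ((1 - ln p) * (1 + ln (real n) - ln p))"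
    have R: "R \<ge> 0"
      using p n by (simp add: R_def)
    show ?thesis
    proof (rule exI[of _ R], rule exI[of _ \<epsilon>], intro conjI allI impI)
      fix q :: real assume q: "0 \<le> q \<and> q \<le> 1"
      show "level_bound n k q \<le> R * ((1 - \<epsilon>) * q + \<epsilon> * p)"
      proof (cases "q = 0")
        case q0: False
        with q have q1: "0 < q" "q \<le> 1" "ln q \<le> 0" by auto
        have pos: "1 \<le> 1 + ln (real n)" "0 \<le> 1 - ln q" "0 \<le> 1 - ln p"
          "0 \<le> 1 + ln (real n) - ln q" "0 \<le> 1 + ln (real n) - ln p"
          using q1 n p by linarith+
        have "sqrt (1 - ln q) * sqrt (1 + ln (real n) - ln q) \<le>
          (sqrt (1 - ln p) * exp (1 / (2 * (1 - ln p)) * (ln p - ln q))) *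
          (sqrt (1 + ln (real n) - ln p) * exp (1 / (2 * (1 + ln (real n) - ln p)) * (ln p - ln q)))"
          by (intro mult_mono sq mult_nonneg_nonneg real_sqrt_ge_zero exp_ge_zero order_refl q1 pos)
        also have "\<dots> = R * exp (\<epsilon> * (ln p - ln q))"
          unfolding R_def \<epsilon>_def real_sqrt_mult distrib_right exp_add by (simp only: ac_simps)
        finally have "q * (sqrt (1 - ln q) * sqrt (1 + ln (real n) - ln q)) \<le> R * ((1 - \<epsilon>) * q + \<epsilon> * p)"
          using q1 assms \<epsilon> R by (intro exp_tangent_le)
        then show ?thesis
          using False q0 by (simp add: level_bound_def real_sqrt_mult)
      qed (use R \<epsilon> assms in \<open>auto simp: level_bound_def\<close>)
    qed (use False assms \<epsilon> in \<open>auto simp: level_bound_def R_def\<close>)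
  qed
qed

text \<open>The supporting line at \<open>p\<close> has slope
  \<open>R * (1 - \<epsilon>) >= 0\<close> and height \<open>R * p\<close> there.\<close>

lemma level_bound_mono:
  assumes "n \<ge> 1" "0 \<le> q" "q \<le> p" "p \<le> 1"
  shows "level_bound n k q \<le> level_bound n k p"
proof (cases "p = 0")
  case True
  then show ?thesis using assms by simp
next
  case False
  with assms have p: "0 < p" by simp
  obtain R \<epsilon> where R: "\<epsilon> \<le> 1" "level_bound n k p = R * p"
     "level_bound n k q \<le> R * ((1 - \<epsilon>) * q + \<epsilon> * p)"
    using level_bound_tangent[OF \<open>n \<ge> 1\<close> p \<open>p \<le> 1\<close>] assms by (meson order_trans)
  have "0 \<le> R * p"
    using level_bound_nonneg[of n p k] assms p R by simp
  then have "0 \<le> R"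
    using p by (simp add: zero_le_mult_iff)
  moreover have "(1 - \<epsilon>) * q + \<epsilon> * p \<le> p"
    using mult_left_mono[of q p "1 - \<epsilon>"] assms R by (simp add: algebra_simps)
  ultimately have "R * ((1 - \<epsilon>) * q + \<epsilon> * p) \<le> R * p"
    by (rule mult_left_mono[rotated])
  then show ?thesis
    using R by linarith
qed

text \<open>Evaluate the supporting line at the mean \<open>p\<close> in every \<open>q u\<close>;
  the average of a linear function is its value at the mean.\<close>

lemma level_bound_Jensen:
  assumes "finite U" "n \<ge> 1" "\<And>u. u \<in> U \<Longrightarrow> 0 \<le> q u \<and> q u \<le> 1"
    and p: "p = (\<Sum>u\<in>U. q u) / real (card U)" "0 < p"
  shows "(\<Sum>u\<in>U. level_bound n k (q u)) \<le> real (card U) * level_bound n k p"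
proof -
  \<comment> \<open>For empty \<open>U\<close> the quotient defining \<open>p\<close> would be
    0.\<close>
  have cU: "card U > 0"
    using p by (auto intro!: Nat.gr0I)
  have sum: "(\<Sum>u\<in>U. q u) = real (card U) * p"
    using p cU by simp
  have "(\<Sum>u\<in>U. q u) \<le> (\<Sum>u\<in>U. 1)"
    using assms by (intro sum_mono) auto
  then have "p \<le> 1"
    using cU by (simp add: p divide_le_eq)
  obtain R \<epsilon> where R: "level_bound n k p = R * p"
     "\<And>q. 0 \<le> q \<Longrightarrow> q \<le> 1 \<Longrightarrow> level_bound n k q \<le> R * ((1 - \<epsilon>) * q + \<epsilon> * p)"
    using level_bound_tangent[OF \<open>n \<ge> 1\<close> \<open>0 < p\<close> \<open>p \<le> 1\<close>] by blast
  have "(\<Sum>u\<in>U. level_bound n k (q u)) \<le> (\<Sum>u\<in>U. R * ((1 - \<epsilon>) * q u + \<epsilon> * p))"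
    using assms by (intro sum_mono R) auto
  also have "\<dots> = R * ((1 - \<epsilon>) * (\<Sum>u\<in>U. q u) + \<epsilon> * p * real (card U))"
    by (simp add: sum.distrib flip: sum_distrib_left)
  also have "\<dots> = real (card U) * level_bound n k p"
    unfolding sum R(1) by (simp add: algebra_simps)
  finally show ?thesis .
qed

text \<open>This serves the case of a single interval and is the source of the constant 2 in the
  theorem.\<close>

lemma level_bound_le_Lam:
  assumes "n \<ge> 1" "0 \<le> p" "p \<le> 1" "k \<in> {1, 2}"
  shows "level_bound n k p \<le> 2 * Lam (n\<^sup>2) k p"
proof (cases "p = 0")
  case True
  then show ?thesis by (simp add: level_bound_def Lam_def)
next
  case False
  then have "p > 0" using assms by simp
  have p: "ln p \<le> 0" and n: "ln (real n) \<ge> 0"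
    using assms \<open>p > 0\<close> by auto
  have nn: "ln (exp 1 / p) = 1 - ln p" "ln (exp 1 * (real n)\<^sup>2) = 1 + 2 * ln (real n)"
     "ln (exp 2 * (real n)\<^sup>2 / p) = 2 + 2 * ln (real n) - ln p"
    using assms \<open>p > 0\<close> by (auto simp: ln_mult ln_div ln_realpow)
  show ?thesis
  proof (cases "k = 1")
    case True
    moreover have "ln p \<le> 1" using p by linarith
    ultimately show ?thesis
      using \<open>p > 0\<close> nn by (auto simp: level_bound_def Lam_def)
  next
    case False
    with assms have k: "k = 2" by auto
    have "sqrt ((1 - ln p) * (1 + ln (real n) - ln p)) \<le> 2 * (Lam (n\<^sup>2) k p / p)"
    proof (cases "p \<le> 1 / real (n\<^sup>2)")
      case True
      \<comment> \<open>Both factors are at most \<open>2 + 2 ln n - ln p\<close>, which is twice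
        the base of the square in \<open>Lam\<close>.\<close>
      have "(1 - ln p) * (1 + ln (real n) - ln p) \<le> (2 + 2 * ln (real n) - ln p)\<^sup>2"
        unfolding power2_eq_square using p n by (intro mult_mono) auto
      then show ?thesis
        using True \<open>p > 0\<close> nn p n unfolding k
        by (simp add: Lam_def power_divide real_sqrt_divide real_le_lsqrt)
    next
      case False
      then have "1 / real (n\<^sup>2) < p" by simp
      then have "ln (1 / real (n\<^sup>2)) < ln p"
        using assms \<open>p > 0\<close> by (subst ln_less_cancel_iff) auto
      then have "- ln p < 2 * ln (real n)"
        using assms by (simp add: ln_div ln_realpow)
      \<comment> \<open>Here \<open>1 + ln n - ln p <= 1 + 3 ln n <= 4 (1 + 2 ln n)\<close>; the 4
        becomes a 2 outside the root.\<close>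
      then have "(1 - ln p) * (1 + ln (real n) - ln p) \<le> (1 - ln p) * (4 * (1 + 2 * ln (real n)))"
        using p n by (intro mult_left_mono) auto
      then have "sqrt ((1 - ln p) * (1 + ln (real n) - ln p)) \<le> sqrt (4 * ((1 - ln p) * (1 + 2 * ln (real n))))"
        by (simp add: ac_simps)
      then show ?thesis
        using False \<open>p > 0\<close> nn unfolding k
        by (simp add: Lam_def real_sqrt_mult)
    qed
    then show ?thesis
      using \<open>p > 0\<close> k by (simp add: level_bound_def field_simps)
  qed
qed

text \<open>At most \<open>m\<close> pieces of total mass at most \<open>r\<close> do worst when
  each has mass \<open>r / m\<close>, so the tangent is taken there. Replacing \<open>r\<close> by
  \<open>r / m\<close> in the logarithm turns \<open>(j - 1) ln m\<close> into
  \<open>j ln m\<close>.\<close>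

lemma sum_Lam_le:
  assumes "finite F" "card F \<le> m" "m \<ge> 1" "j \<ge> 1" "r \<le> 1"
    and p: "\<And>t. t \<in> F \<Longrightarrow> 0 \<le> p t" and sum_p: "(\<Sum>t\<in>F. p t) \<le> r"
  shows "(\<Sum>t\<in>F. Lam m j (p t)) \<le> r * log_pow j (real j + real j * ln (real m)) r"
proof (cases "r \<le> 0")
  case True
  have "0 \<le> (\<Sum>t\<in>F. p t)"
    using p by (intro sum_nonneg)
  with True sum_p have "(\<Sum>t\<in>F. p t) = 0" "r = 0"
    by linarith+
  then have "\<forall>t\<in>F. p t = 0"
    using p assms(1) by (simp add: sum_nonneg_eq_0_iff)
  then show ?thesis
    using \<open>r = 0\<close> by (simp add: Lam_def)
next
  case False
  then have r: "0 < r" by simp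
  define L where "L = real j + real (j - 1) * ln (real m)"
  have eq: "L - ln (r / real m) = real j + real j * ln (real m) - ln r"
    using assms r by (simp add: L_def ln_div of_nat_diff algebra_simps)
  have lm: "0 \<le> ln (real m)" "ln r \<le> 0" "0 \<le> real j * ln (real m)"
    using assms r by auto
  define \<epsilon> where "\<epsilon> = real j / (2 * (L - ln (r / real m)))"
  define R where "R = log_pow j L (r / real m)"
  have jL: "real j \<le> L - ln (r / real m)"
    unfolding eq using lm by linarith
  have \<epsilon>: "0 \<le> \<epsilon>" "\<epsilon> \<le> 1"
    using jL assms by (auto simp: \<epsilon>_def divide_le_eq)
  have R: "0 \<le> R"
    unfolding R_def using jL by (intro log_pow_nonneg) auto
  have "Lam m j (p t) \<le> R * ((1 - \<epsilon>) * p t + \<epsilon> * (r / real m))" if "t \<in> F" for t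
  proof (cases "p t = 0")
    case True
    then show ?thesis
      using R \<epsilon> r by (auto simp: Lam_def)
  next
    case False
    with p that have pt: "0 < p t" by force
    have "p t \<le> (\<Sum>t\<in>F. p t)"
      using p that assms(1) by (intro member_le_sum) auto
    then have pt1: "p t \<le> 1"
      using assms sum_p by linarith
    then have "Lam m j (p t) \<le> p t * log_pow j L (p t)"
      unfolding L_def using pt assms by (intro Lam_le_log_pow) auto
    also have "\<dots> \<le> R * ((1 - \<epsilon>) * p t + \<epsilon> * (r / real m))"
      unfolding R_def
    proof (rule log_pow_tangent)
      have "0 \<le> L" using lm by (simp add: L_def)
      moreover have "ln (p t) \<le> 0" using pt pt1 by simp
      ultimately show "ln (p t) \<le> L" by linarith
    qed (use assms pt jL r \<epsilon>_def in auto)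
    finally show ?thesis .
  qed
  then have "(\<Sum>t\<in>F. Lam m j (p t)) \<le> (\<Sum>t\<in>F. R * ((1 - \<epsilon>) * p t + \<epsilon> * (r / real m)))"
    by (intro sum_mono)
  also have "\<dots> = R * ((1 - \<epsilon>) * (\<Sum>t\<in>F. p t) + \<epsilon> * (real (card F) * (r / real m)))"
    by (simp add: sum.distrib flip: sum_distrib_left)
  also have "\<dots> \<le> R * ((1 - \<epsilon>) * r + \<epsilon> * r)"
  proof -
    have "real (card F) * (r / real m) \<le> real m * (r / real m)"
      using assms r by (intro mult_right_mono) auto
    also have "\<dots> = r"
      using assms by simp
    finally show ?thesis
      using R \<epsilon> sum_p by (intro mult_left_mono add_mono) auto
  qed
  also have "\<dots> = r * log_pow j (real j + real j * ln (real m)) r"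
    unfolding R_def log_pow_def eq by (simp add: algebra_simps)
  finally show ?thesis .
qed

subsection \<open>Summation over dyadic scales\<close>

text \<open>A converse of monotonicity within one dyadic range: from \<open>q\<close> up to
  \<open>(1 / 2) ^ s\<close> the logarithms only shrink, and the leading factor at most
  doubles.\<close>

lemma level_bound_dyadic_le:
  assumes "n \<ge> 1" "q \<le> (1 / 2) ^ s" "(1 / 2) ^ Suc s < q"
  shows "level_bound n k ((1 / 2) ^ s) \<le> 2 * level_bound n k q"
proof -
  have q: "q > 0" "q \<le> 1" "(1/2)^s \<le> 2 * q"
    using assms(2,3) power_le_one[of "1/2::real" s] by (auto intro: less_trans[rotated])
  have l: "ln q \<le> ln ((1 / 2) ^ s)" "ln ((1 / 2 :: real) ^ s) \<le> 0" "ln (real n) \<ge> 0"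
    using q assms by (auto simp: power_le_one)
  have "sqrt (1 - ln ((1 / 2) ^ s)) \<le> sqrt (1 - ln q)"
    using l by simp
  moreover have "sqrt ((1 - ln ((1 / 2) ^ s)) * (1 + ln (real n) - ln ((1 / 2) ^ s)))
      \<le> sqrt ((1 - ln q) * (1 + ln (real n) - ln q))"
    using l by (intro real_sqrt_le_mono mult_mono) linarith+
  ultimately have "(1/2)^s * sqrt (1 - ln ((1 / 2) ^ s)) \<le> 2 * q * sqrt (1 - ln q)"
    "(1/2)^s * sqrt ((1 - ln ((1 / 2) ^ s)) * (1 + ln (real n) - ln ((1 / 2) ^ s)))
      \<le> 2 * q * sqrt ((1 - ln q) * (1 + ln (real n) - ln q))"
    using q l by (intro mult_mono real_sqrt_ge_zero mult_nonneg_nonneg; linarith)+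
  then show ?thesis
    using q by (simp add: level_bound_def)
qed

text \<open>AM-GM merges the logarithms of the two stages: \<open>k\<close> factors \<open>W\<close>
  from the level inequality and \<open>j\<close> factors \<open>X\<close> from the sum over
  monomials have a mean of at most \<open>(L - ln P) / (j + k)\<close>.\<close>

lemma level_bound_mult_log_pow_le:
  fixes n k j s :: nat and r :: real
  assumes "n \<ge> 1" "k \<in> {1, 2}" "j \<ge> 1" "0 < r" "r \<le> 1"
  defines "L \<equiv> real (j + k) + real (j + k - 1) * ln (real (n\<^sup>2))" and "P \<equiv> (1 / 2) ^ s * r"
  shows "level_bound n k ((1 / 2) ^ s) * log_pow j (real j + real j * ln (real (n\<^sup>2))) r
    \<le> 2 * log_pow (j + k) L P * (1 / 2) ^ s"
proof -
  define m where "m = real (n\<^sup>2)"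
  define N where "N = ln (real n)"
  define D where "D = real s * ln 2"
  have m: "ln m = 2 * N"
    using assms by (simp add: m_def N_def ln_realpow)
  have s: "ln ((1 / 2) ^ s) = - D"
    by (simp add: ln_realpow ln_div D_def)
  have P: "ln P = ln r - D"
    using assms s by (simp add: P_def ln_mult)
  have nonneg: "N \<ge> 0" "D \<ge> 0" "ln r \<le> 0"
    using assms by (auto simp: N_def D_def)
  define X where "X = (real j + real j * ln m - ln r) / real j"
  have X: "X \<ge> 0" "real j * X = real j + real j * ln m - ln r"
  proof -
    have "0 \<le> real j + real j * ln m - ln r"
      unfolding m using nonneg mult_nonneg_nonneg[of "real j" "2 * N"] by linarith
    then show "X \<ge> 0"
      by (simp add: X_def)
    show "real j * X = real j + real j * ln m - ln r"
      using assms by (simp add: X_def)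
  qed
  define Y where "Y = (L - ln P) / real (j + k)"
  \<comment> \<open>For \<open>k = 1\<close> the quantity under the root is itself \<open>W\<close>.
    For \<open>k = 2\<close> it is a product of two factors, both at most
    \<open>2 * W = 2 + N + D\<close>; the resulting 4 is the origin of the factor 2 in the
    conclusion.\<close>
  obtain W A where A: "level_bound n k ((1 / 2) ^ s) = (1 / 2) ^ s * sqrt A"
     and "0 \<le> W" "A \<le> 4 * W ^ k" "real k * W + real j * X \<le> L - ln P"
  proof (cases "k = 1")
    case True
    show thesis
    proof (rule that)
      show "level_bound n k ((1 / 2) ^ s) = (1 / 2) ^ s * sqrt (1 + D)"
        using True s by (simp add: level_bound_def)
      show "0 \<le> 1 + D" "1 + D \<le> 4 * (1 + D) ^ k"
        using nonneg True by auto
      show "real k * (1 + D) + real j * X \<le> L - ln P"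
        using True X(2) P m nonneg unfolding L_def m_def[symmetric] by (simp add: algebra_simps)
    qed
  next
    case False
    with assms have k: "k = 2" by simp
    show thesis
    proof (rule that)
      show "level_bound n k ((1 / 2) ^ s) = (1 / 2) ^ s * sqrt ((1 + D) * (1 + N + D))"
        using k s by (simp add: level_bound_def N_def)
      show "0 \<le> 1 + N / 2 + D / 2"
        using nonneg by simp
      have "(1 + D) * (1 + N + D) \<le> (2 * (1 + N / 2 + D / 2))\<^sup>2"
        unfolding power2_eq_square using nonneg by (intro mult_mono) auto
      then show "(1 + D) * (1 + N + D) \<le> 4 * (1 + N / 2 + D / 2) ^ k"
        by (simp only: k power_mult_distrib) simp
      have "real k * (1 + N / 2 + D / 2) + real j * X = 2 + N + D + (real j + real j * ln m - ln r)"
        by (simp add: k X(2))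
      also have "\<dots> \<le> L - ln P"
        using nonneg unfolding P L_def m_def[symmetric] k by (simp add: m algebra_simps)
      finally show "real k * (1 + N / 2 + D / 2) + real j * X \<le> L - ln P" .
    qed
  qed
  have "A * X ^ j \<le> 4 * (W ^ k * X ^ j)"
    using \<open>A \<le> 4 * W ^ k\<close> X by (simp add: mult_right_mono flip: mult.assoc)
  also have "W ^ k * X ^ j \<le> ((real k * W + real j * X) / real (k + j)) ^ (k + j)"
    using assms X \<open>0 \<le> W\<close> by (intro weighted_am_gm) auto
  also have "\<dots> \<le> Y ^ (j + k)"
    unfolding Y_def add.commute[of k j] using \<open>_ \<le> L - ln P\<close>
    by (intro power_mono divide_right_mono divide_nonneg_nonneg add_nonneg_nonneg mult_nonneg_nonneg
        of_nat_0_le_iff \<open>0 \<le> W\<close> X(1))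
  finally have "sqrt (A * X ^ j) \<le> sqrt (4 * Y ^ (j + k))"
    by simp
  then have "sqrt A * log_pow j (real j + real j * ln m) r \<le> 2 * log_pow (j + k) L P"
    by (simp add: log_pow_def X_def Y_def real_sqrt_mult)
  then have "(1 / 2) ^ s * (sqrt A * log_pow j (real j + real j * ln m) r)
      \<le> (1 / 2) ^ s * (2 * log_pow (j + k) L P)"
    by (intro mult_left_mono) auto
  then show ?thesis
    unfolding A by (simp add: m_def ac_simps)
qed

text \<open>This is the cost of moving the argument of \<open>log_pow\<close> by a factor
  \<open>m\<close>, with \<open>x = ln m\<close>, when each logarithmic factor \<open>y\<close> is
  at least \<open>1 + ln m\<close>.\<close>

lemma exp_ln_div_le:
  fixes x y :: real
  assumes "0 \<le> x" "1 + x \<le> y"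
  shows "exp (x / (2 * y)) \<le> 2"
proof -
  have "exp (x / (2 * y)) \<le> exp (1 / 2)"
    using assms by (simp add: divide_le_eq)
  also note exp_half_le
  finally show ?thesis .
qed

text \<open>The scales have total weight at most \<open>2 * p\<close> and their number is at most
  \<open>n <= m\<close>, so the tangent at \<open>p / m\<close> bounds the sum by
  \<open>4 * p * R\<close>. Returning from \<open>p / m\<close> to \<open>p\<close> inside the
  logarithm costs a factor 2.\<close>

lemma sum_level_bound_le_small:
  assumes "n \<ge> 1" "k \<in> {1, 2}" "j \<ge> 1" "N \<le> n"
    and r: "\<And>s. s < N \<Longrightarrow> 0 \<le> r s \<and> r s \<le> 1"
    and sum_r: "(\<Sum>s<N. (1 / 2) ^ s * r s) \<le> 2 * p"
    and p: "0 < p" "p \<le> 1 / real (n\<^sup>2)"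
  shows "(\<Sum>s<N. level_bound n k ((1 / 2) ^ s) * (r s * log_pow j (real j + real j * ln (real (n\<^sup>2))) (r s)))
    \<le> 12 * Lam (n\<^sup>2) (j + k) p"
proof -
  define m where "m = real (n\<^sup>2)"
  define L where "L = real (j + k) + real (j + k - 1) * ln m"
  have m: "m \<ge> 1"
    using assms by (simp add: m_def)
  then have lm: "ln m \<ge> 0" by simp
  have lp: "ln p \<le> - ln m"
  proof -
    have "ln p \<le> ln (1 / m)"
      using p m \<open>n \<ge> 1\<close> by (subst ln_le_cancel_iff) (auto simp: m_def)
    then show ?thesis using m by (simp add: ln_div)
  qed
  have kj: "real (j + k) * ln m = real (j + k - 1) * ln m + ln m"
    using assms by (simp add: of_nat_diff algebra_simps)
  \<comment> \<open>This uses \<open>p <= 1 / m\<close>: the logarithm per factor is at least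
    \<open>1 + ln m\<close>, as \<open>exp_ln_div_le\<close> requires.\<close>
  have Lp: "real (j + k) * (1 + ln m) \<le> L - ln p"
    using lp kj by (simp add: L_def algebra_simps)
  have Lpm: "real (j + k) \<le> L - ln (p / m)"
    using lp lm kj p m Lp
    by (smt (verit) ln_div mult_nonneg_nonneg of_nat_0_le_iff L_def)
  have "0 < real (j + k) * (1 + ln m)"
    using lm assms by (intro mult_pos_pos) auto
  then have lp_le: "ln p < L"
    using Lp by linarith
  define \<epsilon> where "\<epsilon> = real (j + k) / (2 * (L - ln (p / m)))"
  have \<epsilon>: "0 \<le> \<epsilon>" "\<epsilon> \<le> 1"
    using Lpm assms by (auto simp: \<epsilon>_def divide_le_eq)
  define R where "R = log_pow (j + k) L (p / m)"
  have R: "R \<ge> 0"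
    unfolding R_def using Lpm by (intro log_pow_nonneg) auto
  have t: "level_bound n k ((1 / 2) ^ s) * (r s * log_pow j (real j + real j * ln m) (r s))
      \<le> 2 * (R * ((1 - \<epsilon>) * ((1 / 2) ^ s * r s) + \<epsilon> * (p / m)))" if "s < N" for s
  proof (cases "r s = 0")
    case True
    then show ?thesis
      using R \<epsilon> p m by (auto intro!: mult_nonneg_nonneg)
  next
    case False
    with r[OF that] have rs: "0 < r s" "r s \<le> 1" by auto
    define P where "P = (1 / 2) ^ s * r s"
    have P: "0 < P" "P \<le> 1"
      using rs by (auto simp: P_def power_le_one mult_le_one)
    have "level_bound n k ((1 / 2) ^ s) * log_pow j (real j + real j * ln m) (r s)
        \<le> 2 * log_pow (j + k) L P * (1 / 2) ^ s"
      unfolding m_def L_def P_def using assms rs by (intro level_bound_mult_log_pow_le) auto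
    then have "r s * (level_bound n k ((1 / 2) ^ s) * log_pow j (real j + real j * ln m) (r s))
        \<le> r s * (2 * log_pow (j + k) L P * (1 / 2) ^ s)"
      using rs by (intro mult_left_mono) auto
    also have "\<dots> = 2 * (P * log_pow (j + k) L P)"
      by (simp add: P_def)
    also have "P * log_pow (j + k) L P \<le> R * ((1 - \<epsilon>) * P + \<epsilon> * (p / m))"
      unfolding R_def
    proof (rule log_pow_tangent)
      have "ln P \<le> 0" using P by simp
      moreover have "0 \<le> L" using lm by (simp add: L_def)
      ultimately show "ln P \<le> L" by linarith
    qed (use assms P Lpm m \<epsilon>_def in auto)
    finally show ?thesis
      by (simp add: P_def ac_simps)
  qed
  have "(\<Sum>s<N. level_bound n k ((1 / 2) ^ s) * (r s * log_pow j (real j + real j * ln m) (r s)))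
      \<le> (\<Sum>s<N. 2 * (R * ((1 - \<epsilon>) * ((1 / 2) ^ s * r s) + \<epsilon> * (p / m))))"
    by (intro sum_mono t) auto
  also have "\<dots> = 2 * (R * ((1 - \<epsilon>) * (\<Sum>s<N. (1 / 2) ^ s * r s) + \<epsilon> * (p / m * real N)))"
    by (simp add: sum.distrib flip: sum_distrib_left)
  also have "\<dots> \<le> 2 * (R * ((1 - \<epsilon>) * (2 * p) + \<epsilon> * (2 * p)))"
  proof -
    have "real N \<le> m"
      using \<open>N \<le> n\<close> self_le_power[of n 2] \<open>n \<ge> 1\<close> unfolding m_def by (metis of_nat_mono order_trans zero_less_numeral)
    then have "p * real N \<le> p * (2 * m)"
      using p m by (intro mult_left_mono) auto
    then have "p / m * real N \<le> 2 * p"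
      using m by (simp add: field_simps)
    then show ?thesis
      using R \<epsilon> sum_r by (intro mult_left_mono add_mono) auto
  qed
  also have "\<dots> = 4 * p * R"
    by (simp add: algebra_simps)
  also have "4 * p * R \<le> 4 * p * (log_pow (j + k) L p * 2)"
  proof -
    have "R \<le> log_pow (j + k) L p * 2"
    proof -
      have "R \<le> log_pow (j + k) L p * exp (real (j + k) / (2 * (L - ln p)) * (ln p - ln (p / m)))"
        unfolding R_def
        using lp_le Lpm assms by (intro log_pow_le_exp) auto
      also have "real (j + k) / (2 * (L - ln p)) * (ln p - ln (p / m)) = ln m / (2 * ((L - ln p) / real (j + k)))"
        using p m assms by (simp add: ln_div field_simps)
      finally have "R \<le> log_pow (j + k) L p * exp (ln m / (2 * ((L - ln p) / real (j + k))))" .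
      also have "\<dots> \<le> log_pow (j + k) L p * 2"
      proof -
        have "exp (ln m / (2 * ((L - ln p) / real (j + k)))) \<le> 2"
        using lm Lp assms by (intro exp_ln_div_le) (auto simp: le_divide_eq mult.commute)
        then show ?thesis
          using lp_le by (intro mult_left_mono log_pow_nonneg) auto
      qed
      finally show ?thesis .
    qed
    then show ?thesis
      using p by (intro mult_left_mono) auto
  qed
  also have "\<dots> = 8 * Lam (n\<^sup>2) (j + k) p"
    using p assms Lam_eq_small[of p "n\<^sup>2" "j + k"] unfolding L_def m_def by simp
  \<comment> \<open>The constant is weakened to the one that the range of large \<open>p\<close>
    produces.\<close>
  also have "\<dots> \<le> 12 * Lam (n\<^sup>2) (j + k) p"
    using p assms lp_le Lam_eq_small[of p "n\<^sup>2" "j + k"] log_pow_nonneg[of p L "j + k"]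
    unfolding L_def m_def by simp
  finally show ?thesis
    unfolding m_def .
qed

text \<open>The series of \<open>(s + 1) / 2 ^ s\<close> has sum 4; the induction carries the
  explicit remainder.\<close>

lemma sum_half_power_le: "(\<Sum>s<N. (1 / 2) ^ s * (1 + real s)) \<le> (4::real)"
proof -
  have "(\<Sum>s<N. (1 / 2) ^ s * (1 + real s)) = 4 - (2 * real N + 4) * (1 / 2 :: real) ^ N"
    by (induction N) (simp_all add: algebra_simps add_divide_distrib)
  then show ?thesis by simp
qed

text \<open>The dependence on \<open>s\<close> is separated from the power of
  \<open>1 + ln m\<close>, so that the scales can be summed by
  \<open>sum_half_power_le\<close>.\<close>

lemma level_bound_half_power_le:
  assumes "n \<ge> 1" "k \<in> {1, 2}"
  shows "level_bound n k ((1 / 2) ^ s) \<le> (1 / 2) ^ s * (1 + real s) * sqrt ((1 + ln (real (n\<^sup>2))) ^ (k - 1))"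
proof -
  define D where "D = real s * ln 2"
  define N where "N = ln (real n)"
  have N: "0 \<le> N" "ln (real (n\<^sup>2)) = 2 * N"
    using assms by (auto simp: N_def ln_realpow)
  have "ln (2::real) \<le> 1"
    using ln_le_minus_one[of "2::real"] by simp
  then have D: "0 \<le> D" "D \<le> real s"
    using mult_left_mono[of "ln 2" 1 "real s"] by (auto simp: D_def)
  have s: "ln ((1 / 2) ^ s) = - D"
    by (simp add: ln_realpow ln_div D_def)
  have sq: "sqrt ((1 + D)\<^sup>2) \<le> 1 + real s"
    using D by simp
  show ?thesis
  proof (cases "k = 1")
    case True
    have "sqrt (1 + D) \<le> sqrt ((1 + D)\<^sup>2)"
      using D by (intro real_sqrt_le_mono) (simp add: power2_eq_square)
    with sq have "sqrt (1 + D) \<le> 1 + real s" by linarith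
    then show ?thesis
      using True s by (simp add: level_bound_def)
  next
    case False
    then have k: "k = 2" using assms by simp
    have "0 \<le> N * D" using N D by simp
    then have "(1 + D) * (1 + N + D) \<le> (1 + D) * ((1 + D) * (1 + 2 * N))"
      using N D by (intro mult_left_mono) (auto simp: algebra_simps)
    then have "sqrt ((1 + D) * (1 + N + D)) \<le> sqrt ((1 + D)\<^sup>2 * (1 + 2 * N))"
      by (simp add: power2_eq_square ac_simps)
    also have "\<dots> = sqrt ((1 + D)\<^sup>2) * sqrt (1 + 2 * N)"
      by (simp add: real_sqrt_mult)
    also have "\<dots> \<le> (1 + real s) * sqrt (1 + 2 * N)"
      using N by (intro mult_right_mono sq) auto
    finally show ?thesis
      using k s N by (simp add: level_bound_def flip: N_def)
  qed
qed

text \<open>Down to \<open>r s = 1 / m\<close> the factor \<open>log_pow j L (r s)\<close> exceeds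
  \<open>sqrt (M ^ j)\<close> at most by a factor 2. Smaller \<open>r s\<close> are absorbed by an
  additive error of order \<open>1 / m\<close> per scale, which is affordable because
  \<open>1 / m < p\<close>.\<close>

lemma sum_level_bound_le_large:
  assumes "n \<ge> 1" "k \<in> {1, 2}" "j \<ge> 1"
    and r: "\<And>s. s < N \<Longrightarrow> 0 \<le> r s \<and> r s \<le> 1"
    and sum_r: "(\<Sum>s<N. level_bound n k ((1 / 2) ^ s) * r s) \<le> 2 * level_bound n k p"
    and p: "1 / real (n\<^sup>2) < p" "p \<le> 1"
  shows "(\<Sum>s<N. level_bound n k ((1 / 2) ^ s) * (r s * log_pow j (real j + real j * ln (real (n\<^sup>2))) (r s)))
    \<le> 12 * Lam (n\<^sup>2) (j + k) p"
proof -
  define m where "m = real (n\<^sup>2)"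
  define M where "M = 1 + ln m"
  define L where "L = real j + real j * ln m"
  have m: "m \<ge> 1"
    using assms by (simp add: m_def)
  then have lm: "ln m \<ge> 0" by simp
  have M: "M \<ge> 1"
    using lm by (simp add: M_def)
  have mp: "1 \<le> p * m" "p > 0"
  proof -
    show "p > 0"
      using p m by (auto intro: le_less_trans[rotated])
    have "1 / m < p"
      using p by (simp add: m_def)
    then show "1 \<le> p * m"
      using m by (simp add: divide_less_eq split: if_splits)
  qed
  have lp: "ln p \<le> 0" "- ln p \<le> ln m"
  proof -
    have "ln (1 / m) \<le> ln p"
      using p m mp \<open>n \<ge> 1\<close> by (subst ln_le_cancel_iff) (auto simp: m_def)
    then show "- ln p \<le> ln m" using m by (simp add: ln_div)
    show "ln p \<le> 0" using mp p by simp
  qed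
  then have lp1: "ln p \<le> 1" by linarith
  define R where "R = log_pow j L (1 / m)"
  define \<epsilon> where "\<epsilon> = real j / (2 * (L - ln (1 / m)))"
  have L: "real j \<le> L - ln (1 / m)" "real j \<le> L"
    using lm m by (auto simp: L_def ln_div intro: add_nonneg_nonneg)
  have \<epsilon>: "0 \<le> \<epsilon>" "\<epsilon> \<le> 1 / 2"
    using L assms by (auto simp: \<epsilon>_def divide_le_eq)
  have R: "0 \<le> R" "R \<le> 2 * sqrt (M ^ j)"
  proof -
    show "0 \<le> R" unfolding R_def using L by (intro log_pow_nonneg) auto
    have "R \<le> log_pow j L 1 * exp (real j / (2 * (L - ln 1)) * (ln 1 - ln (1 / m)))"
      unfolding R_def using L assms by (intro log_pow_le_exp) auto
    also have "real j / (2 * (L - ln 1)) * (ln 1 - ln (1 / m)) = ln m / (2 * M)"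
    proof -
      have "L - ln 1 = real j * M"
        by (simp add: L_def M_def algebra_simps)
      then show ?thesis
        using m \<open>j \<ge> 1\<close> by (simp add: ln_div)
    qed
    also have "log_pow j L 1 * exp (ln m / (2 * M)) \<le> log_pow j L 1 * 2"
      using lm L by (intro mult_left_mono exp_ln_div_le log_pow_nonneg) (auto simp: M_def)
    also have "log_pow j L 1 = sqrt (M ^ j)"
      using assms by (simp add: log_pow_def L_def M_def add_divide_distrib)
    finally show "R \<le> 2 * sqrt (M ^ j)" by simp
  qed
  \<comment> \<open>In the tangent at \<open>1 / m\<close> the constant term has weight at most 1/2,
    whence the error \<open>1 / (2 * m)\<close>.\<close>
  have t: "r s * log_pow j L (r s) \<le> 2 * sqrt (M ^ j) * (r s + 1 / (2 * m))" if "s < N" for s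
  proof -
    have rs: "0 \<le> r s" "r s \<le> 1" using r[OF that] by auto
    have "r s * log_pow j L (r s) \<le> R * ((1 - \<epsilon>) * r s + \<epsilon> * (1 / m))"
      unfolding R_def
    proof (rule log_pow_tangent)
      assume "r s > 0"
      with rs have "ln (r s) \<le> 0" by simp
      with L show "ln (r s) \<le> L" by linarith
    qed (use assms L m rs \<epsilon>_def in auto)
    also have "\<dots> \<le> 2 * sqrt (M ^ j) * (1 * r s + 1 / 2 * (1 / m))"
      using R \<epsilon> rs m M by (intro mult_mono add_mono) auto
    finally show ?thesis by simp
  qed
  define h where "h s = level_bound n k ((1 / 2) ^ s)" for s
  have h: "0 \<le> h s" for s
    using assms by (auto simp: h_def power_le_one intro!: level_bound_nonneg)
  have "(\<Sum>s<N. h s * (r s * log_pow j L (r s))) \<le> (\<Sum>s<N. h s * (2 * sqrt (M ^ j) * (r s + 1 / (2 * m))))"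
    using h t by (intro sum_mono mult_left_mono) auto
  also have "\<dots> = 2 * sqrt (M ^ j) * ((\<Sum>s<N. h s * r s) + (\<Sum>s<N. h s) / (2 * m))"
    by (simp add: sum_distrib_left sum_divide_distrib flip: sum.distrib) (simp add: algebra_simps)
  \<comment> \<open>The first summand comes from \<open>sum_r\<close> together with a bound for
    \<open>level_bound n k p\<close>, the second from the sum of \<open>h\<close> over all scales
    and \<open>1 / m <= p\<close>. This is where \<open>12 = 2 * (4 + 2)\<close> arises.\<close>
  also have "\<dots> \<le> 2 * sqrt (M ^ j) * (4 * (p * sqrt (1 - ln p) * sqrt (M ^ (k - 1))) + 2 * (p * sqrt (1 - ln p) * sqrt (M ^ (k - 1))))"
  proof (intro mult_left_mono add_mono)
    have "level_bound n k p \<le> 2 * (p * sqrt (1 - ln p) * sqrt (M ^ (k - 1)))"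
    proof (cases "k = 1")
      case True
      moreover have "0 \<le> p * sqrt (1 - ln p)"
        using mp lp(1) by (intro mult_nonneg_nonneg real_sqrt_ge_zero) linarith+
      ultimately show ?thesis
        using mp lp1 by (simp add: level_bound_def)
    next
      case False
      have "ln m = 2 * ln (real n)"
        using assms by (simp add: m_def ln_realpow)
      then have "(1 - ln p) * (1 + ln (real n) - ln p) \<le> (1 - ln p) * (4 * M)"
        using lp lm unfolding M_def by (intro mult_left_mono) auto
      then have "sqrt ((1 - ln p) * (1 + ln (real n) - ln p)) \<le> sqrt ((1 - ln p) * (4 * M))"
        by simp
      also have "\<dots> = 2 * (sqrt (1 - ln p) * sqrt M)"
        by (simp add: real_sqrt_mult)
      finally show ?thesis
        using False assms mp by (auto simp: level_bound_def)
    qed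
    then show "(\<Sum>s<N. h s * r s) \<le> 4 * (p * sqrt (1 - ln p) * sqrt (M ^ (k - 1)))"
      using sum_r by (simp add: h_def)
    have "(\<Sum>s<N. h s) \<le> (\<Sum>s<N. (1 / 2) ^ s * (1 + real s) * sqrt (M ^ (k - 1)))"
      unfolding h_def M_def m_def using assms by (intro sum_mono level_bound_half_power_le) auto
    also have "\<dots> \<le> 4 * sqrt (M ^ (k - 1))"
      unfolding sum_distrib_right[symmetric] using M by (intro mult_right_mono sum_half_power_le) auto
    finally have "(\<Sum>s<N. h s) / (2 * m) \<le> 4 * sqrt (M ^ (k - 1)) / (2 * m)"
      using m by (intro divide_right_mono) auto
    also have "\<dots> = 2 * (1 / m * 1 * sqrt (M ^ (k - 1)))"
      by simp
    also have "\<dots> \<le> 2 * (p * sqrt (1 - ln p) * sqrt (M ^ (k - 1)))"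
      using mp m lp lp1 M by (intro mult_left_mono mult_mono) (auto simp: divide_le_eq)
    finally show "(\<Sum>s<N. h s) / (2 * m) \<le> 2 * (p * sqrt (1 - ln p) * sqrt (M ^ (k - 1)))" .
  qed (use M in auto)
  also have "\<dots> = 12 * (p * sqrt ((1 - ln p) * M ^ (j + k - 1)))"
  proof -
    have "M ^ (j + k - 1) = M ^ j * M ^ (k - 1)"
      using \<open>k \<in> {1, 2}\<close> by (auto simp flip: power_add)
    then show ?thesis
      by (simp add: real_sqrt_mult)
  qed
  also have "\<dots> = 12 * Lam (n\<^sup>2) (j + k) p"
  proof -
    have "\<not> p \<le> 1 / m" "p \<noteq> 0" "real (n\<^sup>2) = m"
      using p mp by (auto simp: m_def)
    then show ?thesis
      unfolding Lam_def using mp m by (simp only: M_def if_False) (simp add: ln_mult ln_div)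
  qed
  finally show ?thesis
    by (simp add: h_def L_def m_def)
qed

text \<open>The lower bound holds for nonzero densities at depth \<open>e\<close>, so
  \<open>e + 1\<close> dyadic scales suffice.\<close>

lemma scale_exists:
  fixes q :: real
  assumes "(1 / 2) ^ e \<le> q" "q \<le> 1"
  shows "\<exists>s\<le>e. q \<le> (1 / 2) ^ s \<and> (1 / 2) ^ Suc s < q"
  using assms
proof (induction e)
  case 0
  then show ?case by auto
next
  case (Suc e)
  show ?case
  proof (cases "(1 / 2) ^ e \<le> q")
    case True
    with Suc show ?thesis using le_SucI by blast
  next
    case False
    show ?thesis
    proof (cases "q = (1 / 2) ^ Suc e")
      case True
      moreover from this have "q > 0" by (simp only: zero_less_power zero_less_divide_1_iff zero_less_numeral)
      ultimately show ?thesis by (intro exI[of _ "Suc e"]) auto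
    next
      case False
      then show ?thesis
        using Suc.prems \<open>\<not> (1 / 2) ^ e \<le> q\<close> by (intro exI[of _ e]) auto
    qed
  qed
qed

subsection \<open>The Fourier norm\<close>

definition monomial :: "nat set \<Rightarrow> (nat \<Rightarrow> real) \<Rightarrow> real" where
  "monomial A x = (\<Prod>i\<in>A. x i)"

lemma finite_cube [simp]: "finite (cube n)"
  by (auto simp: cube_def intro: finite_PiE)

lemma card_cube: "card (cube n) = 2 ^ n"
  by (simp add: cube_def card_PiE numeral_2_eq_2)

lemma cube_cases: "x \<in> cube n \<Longrightarrow> i \<in> {1..n} \<Longrightarrow> x i = 1 \<or> x i = -1"
  by (auto simp: cube_def)

lemma cube_square: "x \<in> cube n \<Longrightarrow> i \<in> {1..n} \<Longrightarrow> x i * x i = 1"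
  using cube_cases[of x n i] by auto

text \<open>Variables of the common part appear squared, and squares are 1 on the cube.\<close>

lemma monomial_mult:
  assumes "x \<in> cube n" "A \<subseteq> {1..n}" "B \<subseteq> {1..n}"
  shows "monomial A x * monomial B x = monomial (sym_diff A B) x"
proof -
  have fin: "finite A" "finite B"
    using assms finite_subset by blast+
  have A: "monomial A x = monomial (A - B) x * monomial (A \<inter> B) x"
    unfolding monomial_def using fin by (subst prod.union_disjoint[symmetric]) (auto intro: prod.cong)
  have B: "monomial B x = monomial (B - A) x * monomial (A \<inter> B) x"
    unfolding monomial_def using fin by (subst prod.union_disjoint[symmetric]) (auto intro: prod.cong)
  have "monomial (A \<inter> B) x * monomial (A \<inter> B) x = (\<Prod>i\<in>A \<inter> B. 1)"
    unfolding monomial_def prod.distrib[symmetric] using assms by (intro prod.cong) (auto simp: cube_square)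
  moreover have "monomial (A - B) x * monomial (B - A) x = monomial (sym_diff A B) x"
    unfolding monomial_def using fin by (subst prod.union_disjoint[symmetric]) auto
  moreover have "monomial A x * monomial B x = (monomial (A - B) x * monomial (B - A) x) *
      (monomial (A \<inter> B) x * monomial (A \<inter> B) x)"
    unfolding A B by (simp only: ac_simps)
  ultimately show ?thesis
    by simp
qed

text \<open>The sum factors over the coordinates: one in \<open>A\<close> contributes
  \<open>-1 + 1 = 0\<close>, any other contributes 2.\<close>

lemma sum_monomial:
  assumes "A \<subseteq> {1..n}"
  shows "(\<Sum>x\<in>cube n. monomial A x) = (if A = {} then 2 ^ n else 0)"
proof -
  define w :: "nat \<Rightarrow> real \<Rightarrow> real" where "w i t = (if i \<in> A then t else 1)" for i t
  have "(\<Sum>x\<in>cube n. monomial A x) = (\<Sum>x\<in>cube n. \<Prod>i\<in>{1..n}. w i (x i))"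
  proof (rule sum.cong)
    fix x
    have "(\<Prod>i\<in>{1..n}. w i (x i)) = (\<Prod>i\<in>{1..n} \<inter> A. x i)"
      unfolding w_def by (simp add: prod.inter_restrict)
    then show "monomial A x = (\<Prod>i\<in>{1..n}. w i (x i))"
      using assms by (simp add: monomial_def Int_absorb1)
  qed simp
  also have "\<dots> = (\<Prod>i\<in>{1..n}. \<Sum>t\<in>{-1, 1}. w i t)"
    unfolding cube_def by (subst prod_sum_PiE) auto
  also have "\<dots> = (\<Prod>i\<in>{1..n}. if i \<in> A then 0 else 2)"
    by (intro prod.cong) (auto simp: w_def)
  also have "\<dots> = (if A = {} then 2 ^ n else 0)"
    using assms by (auto simp: prod_zero_iff)
  finally show ?thesis .
qed

lemma fourier_coeff_monomial:
  assumes "A \<subseteq> {1..n}" "B \<subseteq> {1..n}"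
  shows "fourier_coeff n (monomial A) B = (if A = B then 1 else 0)"
proof -
  have "(\<Sum>x\<in>cube n. monomial A x * (\<Prod>i\<in>B. x i)) = (\<Sum>x\<in>cube n. monomial (sym_diff A B) x)"
    using assms by (intro sum.cong) (auto simp: monomial_mult monomial_def[of B, symmetric])
  also have "\<dots> = (if sym_diff A B = {} then 2 ^ n else 0)"
    using assms by (intro sum_monomial) auto
  finally show ?thesis
    by (auto simp: fourier_coeff_def)
qed

lemma fourier_coeff_cong:
  "(\<And>x. x \<in> cube n \<Longrightarrow> f x = g x) \<Longrightarrow> fourier_coeff n f A = fourier_coeff n g A"
  by (simp add: fourier_coeff_def)

lemma fourier_norm_cong:
  "(\<And>x. x \<in> cube n \<Longrightarrow> f x = g x) \<Longrightarrow> fourier_norm n f = fourier_norm n g"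
  by (simp add: fourier_norm_def fourier_coeff_cong[of n f g])

lemma fourier_coeff_sum:
  "fourier_coeff n (\<lambda>x. \<Sum>t\<in>F. f t x) A = (\<Sum>t\<in>F. fourier_coeff n (f t) A)"
  unfolding fourier_coeff_def sum_distrib_right by (subst sum.swap) (simp add: sum_divide_distrib)

lemma fourier_coeff_scale: "fourier_coeff n (\<lambda>x. c * f x) A = c * fourier_coeff n f A"
  by (simp add: fourier_coeff_def sum_distrib_left mult.assoc)

lemma fourier_coeff_add:
  "fourier_coeff n (\<lambda>x. f x + g x) A = fourier_coeff n f A + fourier_coeff n g A"
  by (simp add: fourier_coeff_def distrib_right sum.distrib add_divide_distrib)

text \<open>Repeated monomials are allowed, since different paths of a tree can query the same
  variables.\<close>

lemma fourier_coeff_sum_monomial: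
  assumes "\<And>t. t \<in> F \<Longrightarrow> V t \<subseteq> {1..n}" "A \<subseteq> {1..n}" "finite F"
  shows "fourier_coeff n (\<lambda>x. \<Sum>t\<in>F. b t * monomial (V t) x) A = (\<Sum>t | t \<in> F \<and> V t = A. b t)"
proof -
  have "fourier_coeff n (\<lambda>x. \<Sum>t\<in>F. b t * monomial (V t) x) A = (\<Sum>t\<in>F. if V t = A then b t else 0)"
    unfolding fourier_coeff_sum fourier_coeff_scale
    using assms by (intro sum.cong) (auto simp: fourier_coeff_monomial)
  also have "\<dots> = (\<Sum>t | t \<in> F \<and> V t = A. b t)"
    using assms by (simp add: sum.inter_filter)
  finally show ?thesis .
qed

lemma fourier_norm_scale: "fourier_norm n (\<lambda>x. c * f x) = \<bar>c\<bar> * fourier_norm n f"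
  by (simp add: fourier_norm_def fourier_coeff_scale abs_mult sum_distrib_left)

lemma fourier_norm_sum:
  "fourier_norm n (\<lambda>x. \<Sum>t\<in>F. f t x) \<le> (\<Sum>t\<in>F. fourier_norm n (f t))"
  unfolding fourier_norm_def fourier_coeff_sum 
  by (rule order_trans[OF sum_mono[OF sum_abs]]) (subst sum.swap, simp)

lemma fourier_norm_add:
  "fourier_norm n (\<lambda>x. f x + g x) \<le> fourier_norm n f + fourier_norm n g"
  unfolding fourier_norm_def fourier_coeff_add by (simp add: sum_mono abs_triangle_ineq flip: sum.distrib)

lemma fourier_norm_zero [simp]: "fourier_norm n (\<lambda>x. 0) = 0"
  by (simp add: fourier_norm_def fourier_coeff_def)

text \<open>The multiplication only permutes the Fourier coefficients, sending \<open>S\<close> to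
  \<open>sym_diff A S\<close>.\<close>

lemma fourier_norm_monomial_mult:
  assumes "A \<subseteq> {1..n}"
  shows "fourier_norm n (\<lambda>x. monomial A x * f x) = fourier_norm n f"
proof -
  have "fourier_coeff n (\<lambda>x. monomial A x * f x) S = fourier_coeff n f (sym_diff A S)" if "S \<subseteq> {1..n}" for S
    unfolding fourier_coeff_def
    using assms that monomial_mult[OF _ assms that]
    by (intro arg_cong2[where f = "(/)"] sum.cong refl) (simp add: ac_simps flip: monomial_def)
  then have "fourier_norm n (\<lambda>x. monomial A x * f x) = (\<Sum>S\<in>Pow {1..n}. \<bar>fourier_coeff n f (sym_diff A S)\<bar>)"
    unfolding fourier_norm_def by (intro sum.cong) auto
  also have "\<dots> = fourier_norm n f"
    unfolding fourier_norm_def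
    using assms by (intro sum.reindex_bij_witness[of _ "sym_diff A" "sym_diff A"]) auto
  finally show ?thesis .
qed

text \<open>A point of the unit ball of the space spanned by the \<open>X v A\<close>, A in \<open>\<A>\<close>, is a convex combination of
  signed vectors \<open>X v A\<close> and 0, and a convex function on a product of such balls is maximal at
  a vertex.\<close>

lemma fourier_norm_extreme:
  assumes "finite V" "finite \<A>"
    and "\<And>v. v \<in> V \<Longrightarrow> (\<Sum>A\<in>\<A>. \<bar>a v A\<bar>) \<le> 1"
    and "\<And>\<epsilon> \<sigma>. (\<And>v. v \<in> V \<Longrightarrow> \<epsilon> v \<in> {-1, 0, 1 :: real} \<and> (\<epsilon> v \<noteq> 0 \<longrightarrow> \<sigma> v \<in> \<A>)) \<Longrightarrow>
      fourier_norm n (\<lambda>x. Y x + (\<Sum>v\<in>V. \<epsilon> v * X v (\<sigma> v) x)) \<le> B"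
  shows "fourier_norm n (\<lambda>x. Y x + (\<Sum>v\<in>V. \<Sum>A\<in>\<A>. a v A * X v A x)) \<le> B"
  using assms(1,3,4)
proof (induction V arbitrary: Y rule: finite_induct)
  case empty
  then show ?case by simp
next
  case (insert v V)
  define Z where "Z x = Y x + (\<Sum>v\<in>V. \<Sum>A\<in>\<A>. a v A * X v A x)" for x
  have vertex: "fourier_norm n (\<lambda>x. Z x + s * X v A x) \<le> B" if "s \<in> {-1, 0, 1}" "s \<noteq> 0 \<longrightarrow> A \<in> \<A>" for s A
  proof -
    \<comment> \<open>The vertex chosen for \<open>v\<close> is moved into the fixed summand; the
      induction keeps \<open>Y\<close> arbitrary for this purpose.\<close>
    have "fourier_norm n (\<lambda>x. (Y x + s * X v A x) + (\<Sum>v\<in>V. \<Sum>A\<in>\<A>. a v A * X v A x)) \<le> B"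
    proof (rule insert.IH)
      fix \<epsilon> :: "'a \<Rightarrow> real" and \<sigma>
      assume *: "\<And>w. w \<in> V \<Longrightarrow> \<epsilon> w \<in> {-1, 0, 1} \<and> (\<epsilon> w \<noteq> 0 \<longrightarrow> \<sigma> w \<in> \<A>)"
      have eq: "(\<Sum>w\<in>V. (\<epsilon>(v := s)) w * X w ((\<sigma>(v := A)) w) x) = (\<Sum>w\<in>V. \<epsilon> w * X w (\<sigma> w) x)" for x
        using insert.hyps by (intro sum.cong) auto
      have "fourier_norm n (\<lambda>x. Y x + (\<Sum>w\<in>insert v V. (\<epsilon>(v := s)) w * X w ((\<sigma>(v := A)) w) x)) \<le> B"
        using * that by (intro insert.prems) auto
      then show "fourier_norm n (\<lambda>x. (Y x + s * X v A x) + (\<Sum>w\<in>V. \<epsilon> w * X w (\<sigma> w) x)) \<le> B"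
        unfolding sum.insert[OF insert.hyps] eq by (simp add: add.assoc)
    qed (use insert.prems in auto)
    then show ?thesis
      by (simp add: Z_def ac_simps)
  qed
  have a: "(\<Sum>A\<in>\<A>. \<bar>a v A\<bar>) \<le> 1"
    using insert.prems by simp
  \<comment> \<open>A convex combination of signed vertices; the remaining weight goes to the vertex
    0, where only \<open>Z\<close> is left.\<close>
  have "fourier_norm n (\<lambda>x. Y x + (\<Sum>v\<in>insert v V. \<Sum>A\<in>\<A>. a v A * X v A x))
      = fourier_norm n (\<lambda>x. (1 - (\<Sum>A\<in>\<A>. \<bar>a v A\<bar>)) * Z x + (\<Sum>A\<in>\<A>. \<bar>a v A\<bar> * (Z x + sgn (a v A) * X v A x)))"
  proof (rule fourier_norm_cong)
    fix x
    have "(\<Sum>A\<in>\<A>. \<bar>a v A\<bar> * (Z x + sgn (a v A) * X v A x))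
        = (\<Sum>A\<in>\<A>. \<bar>a v A\<bar>) * Z x + (\<Sum>A\<in>\<A>. a v A * X v A x)"
      by (simp add: distrib_left sum.distrib sum_distrib_right abs_mult_sgn flip: mult.assoc)
    then show "Y x + (\<Sum>v\<in>insert v V. \<Sum>A\<in>\<A>. a v A * X v A x)
        = (1 - (\<Sum>A\<in>\<A>. \<bar>a v A\<bar>)) * Z x + (\<Sum>A\<in>\<A>. \<bar>a v A\<bar> * (Z x + sgn (a v A) * X v A x))"
      using insert.hyps by (simp add: Z_def left_diff_distrib)
  qed
  also have "\<dots> \<le> fourier_norm n (\<lambda>x. (1 - (\<Sum>A\<in>\<A>. \<bar>a v A\<bar>)) * Z x)
      + (\<Sum>A\<in>\<A>. fourier_norm n (\<lambda>x. \<bar>a v A\<bar> * (Z x + sgn (a v A) * X v A x)))"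
    by (rule order_trans[OF fourier_norm_add add_left_mono[OF fourier_norm_sum]])
  also have "\<dots> \<le> (1 - (\<Sum>A\<in>\<A>. \<bar>a v A\<bar>)) * B + (\<Sum>A\<in>\<A>. \<bar>a v A\<bar> * B)"
  proof (intro add_mono sum_mono)
    have "fourier_norm n Z \<le> B"
      using vertex[of 0] by simp
    then show "fourier_norm n (\<lambda>x. (1 - (\<Sum>A\<in>\<A>. \<bar>a v A\<bar>)) * Z x) \<le> (1 - (\<Sum>A\<in>\<A>. \<bar>a v A\<bar>)) * B"
      unfolding fourier_norm_scale using a by (simp add: mult_left_mono)
  next
    fix A assume "A \<in> \<A>"
    then have "fourier_norm n (\<lambda>x. Z x + sgn (a v A) * X v A x) \<le> B"
      by (intro vertex) (auto simp: sgn_if)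
    then show "fourier_norm n (\<lambda>x. \<bar>a v A\<bar> * (Z x + sgn (a v A) * X v A x)) \<le> \<bar>a v A\<bar> * B"
      unfolding fourier_norm_scale by (simp add: mult_left_mono)
  qed
  also have "\<dots> = B"
    by (simp add: algebra_simps sum_distrib_left)
  finally show ?case .
qed

subsection \<open>Families of sets\<close>

text \<open>Sets in \<open>\<R>\<close> number the levels of a subtree from 1; the shift by
  \<open>d\<close> turns them into levels of the whole tree.\<close>

definition append_sets :: "nat \<Rightarrow> nat set set \<Rightarrow> nat set set \<Rightarrow> nat set set" where
  "append_sets d \<S> \<R> = (\<lambda>(S, R). S \<union> (+) d ` R) ` (\<S> \<times> \<R>)"

text \<open>A union is decoded into its part up to \<open>d\<close> and the shifted rest, so sums
  over \<open>append_sets\<close> become double sums.\<close>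

lemma inj_on_append_sets:
  fixes d e :: nat
  assumes "\<S> \<subseteq> Pow {1..d}" "\<R> \<subseteq> Pow {1..e}"
  shows "inj_on (\<lambda>(S, R). S \<union> (+) d ` R) (\<S> \<times> \<R>)"
proof (rule inj_on_inverseI[where g = "\<lambda>X. (X \<inter> {1..d}, {i. i \<ge> 1 \<and> d + i \<in> X})"])
  fix t assume "t \<in> \<S> \<times> \<R>"
  then obtain S R where t: "t = (S, R)" and "S \<in> \<S>" "R \<in> \<R>"
    by blast
  then have "S \<subseteq> {1..d}" "R \<subseteq> {1..e}"
    using assms by blast+
  have R: "1 \<le> i" if "i \<in> R" for i
    using \<open>R \<subseteq> {1..e}\<close> that by auto
  have dS: "d + i \<notin> S" if "1 \<le> i" for i
  proof
    assume "d + i \<in> S"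
    then have "d + i \<in> {1..d}"
      using \<open>S \<subseteq> {1..d}\<close> by blast
    with that show False by simp
  qed
  have "(+) d ` R \<inter> {1..d} = {}"
    by (auto dest: R)
  then have "(S \<union> (+) d ` R) \<inter> {1..d} = S"
    using \<open>S \<subseteq> {1..d}\<close> by blast
  moreover have "{i. i \<ge> 1 \<and> d + i \<in> S \<union> (+) d ` R} = R"
    using dS R by (auto simp: image_iff)
  ultimately show "((case t of (S, R) \<Rightarrow> S \<union> (+) d ` R) \<inter> {1..d},
      {i. i \<ge> 1 \<and> d + i \<in> (case t of (S, R) \<Rightarrow> S \<union> (+) d ` R)}) = t"
    by (simp add: t)
qed

text \<open>The iterated join freed from the order of its factors. The index set is arbitrary
  because the induction removes the deepest interval, whose index need not be the largest.\<close>

definition blocks :: "('i \<Rightarrow> nat set) \<Rightarrow> ('i \<Rightarrow> nat) \<Rightarrow> 'i set \<Rightarrow> nat set set" where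
  "blocks I k J = {S. S \<subseteq> (\<Union>j\<in>J. I j) \<and> (\<forall>j\<in>J. card (S \<inter> I j) = k j)}"

lemma blocks_eq_append_sets:
  assumes "j \<in> J" "I j = {d + 1..d + e}" "(\<Union>i\<in>J - {j}. I i) = {1..d}"
  shows "blocks I k J = append_sets d (blocks I k (J - {j})) (nsets {1..e} (k j))"
proof (intro set_eqI iffI)
  fix S assume S: "S \<in> blocks I k J"
  have "(\<Union>i\<in>J. I i) = {1..d} \<union> I j"
    using assms(1,3) by blast
  then have sub: "S \<subseteq> {1..d} \<union> I j"
    using S by (simp add: blocks_def)
  define R where "R = (\<lambda>i. i - d) ` (S \<inter> I j)"
  have "R \<subseteq> {1..e}"
    unfolding R_def assms(2) by auto
  have im: "(+) d ` R = S \<inter> I j"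
    unfolding R_def image_image assms(2) by (intro trans[OF image_cong[OF refl] image_ident]) auto
  have eq: "S = (S \<inter> {1..d}) \<union> (+) d ` R"
    unfolding im using sub by blast
  have "card R = k j"
    using S assms(1) card_image[of "(+) d" R] by (simp add: blocks_def im)
  with \<open>R \<subseteq> {1..e}\<close> have "R \<in> nsets {1..e} (k j)"
    by (simp add: nsets_def finite_subset[OF _ finite_atLeastAtMost])
  moreover have "S \<inter> {1..d} \<inter> I i = S \<inter> I i" if "i \<in> J - {j}" for i
    using assms(3) that by blast
  then have "S \<inter> {1..d} \<in> blocks I k (J - {j})"
    using S assms(3) by (simp add: blocks_def)
  ultimately show "S \<in> append_sets d (blocks I k (J - {j})) (nsets {1..e} (k j))"
    unfolding append_sets_def
    by (intro image_eqI[of _ _ "(S \<inter> {1..d}, R)"]) (use eq in auto)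
next
  fix X assume "X \<in> append_sets d (blocks I k (J - {j})) (nsets {1..e} (k j))"
  then obtain S R where X: "X = S \<union> (+) d ` R" and S: "S \<in> blocks I k (J - {j})"
     and R: "R \<subseteq> {1..e}" "card R = k j"
    by (auto simp: append_sets_def nsets_def)
  have sub: "S \<subseteq> {1..d}" "(+) d ` R \<subseteq> I j"
    using S R assms(2,3) by (auto simp: blocks_def)
  have disj: "{1..d} \<inter> I j = {}"
    unfolding assms(2) by auto
  have "X \<inter> I j = (+) d ` R"
    using sub disj unfolding X by blast
  then have "card (X \<inter> I j) = k j"
    using R(2) by (simp add: card_image)
  moreover have "card (X \<inter> I i) = k i" if "i \<in> J - {j}" for i
  proof -
    have "I i \<subseteq> {1..d}"
      using assms(3) that by blast
    then have "X \<inter> I i = S \<inter> I i"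
      using sub disj unfolding X by blast
    then show ?thesis
      using S that by (simp add: blocks_def)
  qed
  moreover have "X \<subseteq> (\<Union>j\<in>J. I j)"
    using S sub(2) assms(1) unfolding X by (auto simp: blocks_def)
  ultimately show "X \<in> blocks I k J"
    by (auto simp: blocks_def)
qed

text \<open>An infinite set has \<open>card\<close> 0, so with \<open>k i = 0\<close> the family
  \<open>blocks\<close> can contain infinite sets, while \<open>nsets\<close> cannot; hence the
  intersection.\<close>

lemma fam_joins_eq_blocks:
  assumes "disjoint_family_on I {1..l}"
  shows "fam_joins (\<lambda>i. nsets (I i) (k i)) l = {S. finite S} \<inter> blocks I k {1..l}"
  using assms
proof (induction l)
  case 0
  then show ?case by (auto simp: blocks_def)
next
  case (Suc l)
  have J: "{1..Suc l} = insert (Suc l) {1..l}" by auto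
  have disj: "(\<Union>i\<in>{1..l}. I i) \<inter> I (Suc l) = {}"
    using disjoint_family_onD[OF Suc.prems, of _ "Suc l"] by fastforce
  have IH: "fam_joins (\<lambda>i. nsets (I i) (k i)) l = {S. finite S} \<inter> blocks I k {1..l}"
    using Suc.prems by (intro Suc.IH) (auto simp: disjoint_family_on_def)
  show ?case
  proof (intro set_eqI iffI)
    fix X assume "X \<in> fam_joins (\<lambda>i. nsets (I i) (k i)) (Suc l)"
    then obtain A B where X: "X = A \<union> B" and A: "finite A" "A \<in> blocks I k {1..l}"
      and "B \<in> nsets (I (Suc l)) (k (Suc l))"
      by (auto simp: IH fam_join_def)
    then have B: "B \<subseteq> I (Suc l)" "finite B" "card B = k (Suc l)"
      by (auto simp: nsets_def)
    have "A \<subseteq> (\<Union>i\<in>{1..l}. I i)"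
      using A by (simp add: blocks_def)
    then have "X \<inter> I (Suc l) = B" "\<forall>i\<in>{1..l}. X \<inter> I i = A \<inter> I i"
      using B disj unfolding X by blast+
    then show "X \<in> {S. finite S} \<inter> blocks I k {1..Suc l}"
      using A B unfolding J by (auto simp: blocks_def X)
  next
    fix X assume X: "X \<in> {S. finite S} \<inter> blocks I k {1..Suc l}"
    have "X = (X - I (Suc l)) \<union> (X \<inter> I (Suc l))"
      by blast
    moreover have "X \<inter> I (Suc l) \<in> nsets (I (Suc l)) (k (Suc l))"
      using X by (auto simp: blocks_def nsets_def)
    moreover have "(X - I (Suc l)) \<inter> I i = X \<inter> I i" if "i \<in> {1..l}" for i
      using disj that by blast
    then have "X - I (Suc l) \<in> {S. finite S} \<inter> blocks I k {1..l}"
      using X unfolding J by (auto simp: blocks_def)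
    ultimately show "X \<in> fam_joins (\<lambda>i. nsets (I i) (k i)) (Suc l)"
      by (auto simp: IH fam_join_def)
  qed
qed

subsection \<open>Decision trees\<close>

lemma strings_altdef: "strings d = {v. set v \<subseteq> {-1, 1} \<and> length v = d}"
  by (auto simp: strings_def)

lemma finite_strings [simp]: "finite (strings d)"
  by (simp add: strings_altdef finite_lists_length_eq)

lemma card_strings: "card (strings d) = 2 ^ d"
  by (simp add: strings_altdef card_lists_length_eq numeral_2_eq_2)

lemma length_strings: "v \<in> strings d \<Longrightarrow> length v = d"
  by (simp add: strings_def)

lemma strings_take: "v \<in> strings d \<Longrightarrow> j \<le> d \<Longrightarrow> take j v \<in> strings j"
  by (auto simp: strings_def dest: in_set_takeD)

lemma strings_append_iff:
  "length u = d \<Longrightarrow> u @ w \<in> strings (d + e) \<longleftrightarrow> u \<in> strings d \<and> w \<in> strings e"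
  by (auto simp: strings_def)

lemma sum_strings_append:
  "(\<Sum>v\<in>strings (d + e). f v) = (\<Sum>u\<in>strings d. \<Sum>w\<in>strings e. f (u @ w))"
proof -
  have "(\<Sum>v\<in>strings (d + e). f v) = (\<Sum>(u, w)\<in>strings d \<times> strings e. f (u @ w))"
    by (rule sum.reindex_bij_witness[of _ "\<lambda>(u, w). u @ w" "\<lambda>v. (take d v, drop d v)"])
      (auto simp: strings_def dest: in_set_takeD in_set_dropD)
  then show ?thesis
    by (simp add: sum.cartesian_product)
qed

declare One_nat_def [simp del]

lemma nth_strings: "v \<in> strings d \<Longrightarrow> i < d \<Longrightarrow> v ! i = 1 \<or> v ! i = -1"
  unfolding strings_def using nth_mem[of i v] by blast

text \<open>The conditions of \<open>is_dtree\<close> on the queries alone. Kept apart from the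
  leaves, a query function can be truncated or shifted to a subtree and combined with new
  labels.\<close>

definition valid_queries :: "nat \<Rightarrow> nat \<Rightarrow> (real list \<Rightarrow> nat) \<Rightarrow> bool" where
  "valid_queries n d Q \<longleftrightarrow> (\<forall>j<d. \<forall>v\<in>strings j. Q v \<in> {1..n}) \<and>
     (\<forall>v\<in>strings d. inj_on (\<lambda>i. Q (take (i - 1) v)) {1..d})"

definition path_vars :: "(real list \<Rightarrow> nat) \<Rightarrow> real list \<Rightarrow> nat set \<Rightarrow> nat set" where
  "path_vars Q v S = (\<lambda>i. Q (take (i - 1) v)) ` S"

definition path_sum ::
    "(real list \<Rightarrow> nat) \<Rightarrow> nat set set \<Rightarrow> real list \<Rightarrow> (nat \<Rightarrow> real) \<Rightarrow> real" where
  "path_sum Q \<S> v x = (\<Sum>S\<in>\<S>. \<Prod>i\<in>S. v ! (i - 1) * x (Q (take (i - 1) v)))"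

text \<open>For constant leaves this is \<open>tree_part\<close> with the sums exchanged, leaves
  outside and level sets inside, so that leaves can be grouped by their ancestors.\<close>

definition tree_sum ::
    "(real list \<Rightarrow> nat) \<Rightarrow> nat \<Rightarrow> nat set set \<Rightarrow> (real list \<Rightarrow> real) \<Rightarrow> (nat \<Rightarrow> real) \<Rightarrow> real" where
  "tree_sum Q d \<S> c x = (\<Sum>v\<in>strings d. c v / 2 ^ d * path_sum Q \<S> v x)"

lemma valid_queries_range:
  assumes "valid_queries n d Q" "v \<in> strings d" "i \<in> {1..d}"
  shows "Q (take (i - 1) v) \<in> {1..n}"
proof -
  have "i - 1 < d" "take (i - 1) v \<in> strings (i - 1)"
    using assms by (auto intro: strings_take)
  then show ?thesis
    using assms(1) unfolding valid_queries_def by blast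
qed

lemma path_vars_subset:
  "valid_queries n d Q \<Longrightarrow> v \<in> strings d \<Longrightarrow> S \<subseteq> {1..d} \<Longrightarrow> path_vars Q v S \<subseteq> {1..n}"
  using valid_queries_range by (fastforce simp: path_vars_def)

lemma card_path_vars:
  assumes "valid_queries n d Q" "v \<in> strings d" "S \<subseteq> {1..d}"
  shows "card (path_vars Q v S) = card S"
  using assms unfolding valid_queries_def path_vars_def by (meson card_image inj_on_subset)

lemma path_prod_eq:
  assumes "valid_queries n d Q" "v \<in> strings d" "S \<subseteq> {1..d}"
  shows "(\<Prod>i\<in>S. v ! (i - 1) * x (Q (take (i - 1) v))) = (\<Prod>i\<in>S. v ! (i - 1)) * monomial (path_vars Q v S) x"
proof -
  have "inj_on (\<lambda>i. Q (take (i - 1) v)) S"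
    using assms inj_on_subset unfolding valid_queries_def by blast
  then show ?thesis
    by (simp add: prod.distrib monomial_def path_vars_def prod.reindex)
qed

text \<open>A path queries \<open>d\<close> distinct variables out of \<open>n\<close>. This later
  bounds the number of dyadic scales by \<open>n\<close>.\<close>

lemma valid_queries_le:
  assumes "valid_queries n d Q"
  shows "d \<le> n"
proof -
  have v: "replicate d 1 \<in> strings d"
    by (auto simp: strings_def)
  have "card {1..d} \<le> card {1..n}"
    using path_vars_subset[OF assms v, of "{1..d}"] card_path_vars[OF assms v, of "{1..d}"]
    by (metis card_mono finite_atLeastAtMost order_refl)
  then show ?thesis by simp
qed

lemma valid_queries_prefix:
  assumes "valid_queries n (d + e) Q"
  shows "valid_queries n d Q"
  unfolding valid_queries_def
proof (intro conjI ballI allI impI)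
  fix v assume v: "v \<in> strings d"
  \<comment> \<open>Any extension to a full path will do; injectivity is then restricted to the
    prefix.\<close>
  have "v @ replicate e 1 \<in> strings (d + e)"
    using v by (auto simp: strings_def)
  then have "inj_on (\<lambda>i. Q (take (i - 1) (v @ replicate e 1))) {1..d}"
    using assms unfolding valid_queries_def by (meson inj_on_subset atLeastatMost_subset_iff le_add1 order_refl)
  moreover have "inj_on (\<lambda>i. Q (take (i - 1) (v @ replicate e 1))) {1..d} =
      inj_on (\<lambda>i. Q (take (i - 1) v)) {1..d}"
    by (rule inj_on_cong) (use length_strings[OF v] in auto)
  ultimately show "inj_on (\<lambda>i. Q (take (i - 1) v)) {1..d}"
    by simp
next
  fix j v assume "j < d" "v \<in> strings j"
  then show "Q v \<in> {1..n}"
    using assms unfolding valid_queries_def by (meson trans_less_add1)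
qed

lemma valid_queries_subtree:
  assumes "valid_queries n (d + e) Q" "u \<in> strings d"
  shows "valid_queries n e (\<lambda>w. Q (u @ w))"
  unfolding valid_queries_def
proof (intro conjI ballI allI impI)
  fix j v assume "j < e" "v \<in> strings j"
  then have "u @ v \<in> strings (d + j)" "d + j < d + e"
    using assms by (auto simp: strings_def)
  then show "Q (u @ v) \<in> {1..n}"
    using assms unfolding valid_queries_def by blast
next
  fix w assume w: "w \<in> strings e"
  have "u @ w \<in> strings (d + e)"
    using w assms by (auto simp: strings_def)
  then have inj: "inj_on (\<lambda>i. Q (take (i - 1) (u @ w))) {1..d + e}"
    using assms unfolding valid_queries_def by blast
  show "inj_on (\<lambda>i. Q (u @ take (i - 1) w)) {1..e}"
  proof (rule inj_onI)
    fix i i' assume *: "i \<in> {1..e}" "i' \<in> {1..e}" "Q (u @ take (i - 1) w) = Q (u @ take (i' - 1) w)"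
    moreover from this have "take (d + i - 1) (u @ w) = u @ take (i - 1) w"
        "take (d + i' - 1) (u @ w) = u @ take (i' - 1) w"
      using length_strings[OF assms(2)] by auto
    ultimately have "Q (take (d + i - 1) (u @ w)) = Q (take (d + i' - 1) (u @ w))"
      by simp
    then have "d + i = d + i'"
      by (rule inj_onD[OF inj]) (use *(1,2) in simp_all)
    then show "i = i'" by simp
  qed
qed

section \<open>Evaluation along a path and Fourier expansion of trees\<close>

lemma path_mem_strings:
  assumes "x \<in> cube n" "valid_queries n d (query T)" "j \<le> d"
  shows "path T x j \<in> strings j"
  using assms(3)
proof (induction j)
  case 0
  then show ?case by (simp add: strings_def)
next
  case (Suc j)
  then have "path T x j \<in> strings j" by simp
  moreover from this have "query T (path T x j) \<in> {1..n}"
    using Suc.prems assms unfolding valid_queries_def by (meson Suc_le_lessD)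
  ultimately show ?case
    using cube_cases[OF assms(1)] by (fastforce simp: strings_def)
qed

lemma path_eq_iff:
  "length v = d \<Longrightarrow> path T x d = v \<longleftrightarrow> (\<forall>i\<in>{1..d}. v ! (i - 1) = x (query T (take (i - 1) v)))"
proof (induction d arbitrary: v)
  case 0
  then show ?case by simp
next
  case (Suc d)
  then obtain w t where v: "v = w @ [t]" "length w = d"
    by (metis length_Suc_conv_rev)
  have "path T x (Suc d) = v \<longleftrightarrow> path T x d = w \<and> t = x (query T w)"
    by (auto simp: v)
  also have "\<dots> \<longleftrightarrow> (\<forall>i\<in>{1..Suc d}. v ! (i - 1) = x (query T (take (i - 1) v)))"
  proof -
    have "{1..Suc d} = insert (Suc d) {1..d}"
      by auto
    then show ?thesis
      unfolding Suc.IH[OF v(2)] using v by (auto simp: nth_append)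
  qed
  finally show ?case .
qed

text \<open>The sum over all level sets expands the product of the \<open>f i + 1\<close>, where
  \<open>f i\<close> is 1 if \<open>x\<close> agrees with \<open>v\<close> at level \<open>i\<close>
  and -1 otherwise. Up to \<open>2 ^ d\<close> it is the indicator that \<open>x\<close> leads to
  the leaf \<open>v\<close>.\<close>

lemma path_sum_Pow:
  assumes "x \<in> cube n" "valid_queries n d (query T)" "v \<in> strings d"
  shows "path_sum (query T) (Pow {1..d}) v x = (if path T x d = v then 2 ^ d else 0)"
proof -
  define f where "f i = v ! (i - 1) * x (query T (take (i - 1) v))" for i
  have f: "f i = (if v ! (i - 1) = x (query T (take (i - 1) v)) then 1 else - 1)" if "i \<in> {1..d}" for i
    using nth_strings[OF assms(3), of "i - 1"] cube_cases[OF assms(1) valid_queries_range[OF assms(2,3) that]] that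
    by (auto simp: f_def)
  have "path_sum (query T) (Pow {1..d}) v x = (\<Prod>i\<in>{1..d}. f i + 1)"
    by (simp add: path_sum_def f_def prod_add)
  also have "\<dots> = (if path T x d = v then 2 ^ d else 0)"
  proof (cases "path T x d = v")
    case True
    then have "(\<Prod>i\<in>{1..d}. f i + 1) = (\<Prod>i\<in>{1..d}. 2)"
      using f path_eq_iff[OF length_strings[OF assms(3)]] by (intro prod.cong) auto
    with True show ?thesis by simp
  next
    case False
    then obtain i where "i \<in> {1..d}" "f i = -1"
      using f path_eq_iff[OF length_strings[OF assms(3)]] by metis
    then have "\<exists>a\<in>{1..d}. f a + 1 = 0"
      by (intro bexI[of _ i]) auto
    with False show ?thesis
      by simp
  qed
  finally show ?thesis .
qed

lemma tree_sum_Pow: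
  assumes "x \<in> cube n" "valid_queries n d (query T)"
  shows "tree_sum (query T) d (Pow {1..d}) c x = c (path T x d)"
proof -
  have "tree_sum (query T) d (Pow {1..d}) c x = (\<Sum>v\<in>strings d. if path T x d = v then c v else 0)"
    unfolding tree_sum_def using assms by (intro sum.cong) (auto simp: path_sum_Pow)
  then show ?thesis
    using path_mem_strings[OF assms order_refl] by simp
qed

lemma tree_sum_monomials:
  assumes "valid_queries n d Q" "\<S> \<subseteq> Pow {1..d}"
  shows "tree_sum Q d \<S> c x = (\<Sum>(v, S)\<in>strings d \<times> \<S>.
      c v / 2 ^ d * (\<Prod>i\<in>S. v ! (i - 1)) * monomial (path_vars Q v S) x)"
proof -
  have "tree_sum Q d \<S> c x = (\<Sum>v\<in>strings d. \<Sum>S\<in>\<S>.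
      c v / 2 ^ d * (\<Prod>i\<in>S. v ! (i - 1)) * monomial (path_vars Q v S) x)"
    unfolding tree_sum_def path_sum_def sum_distrib_left
  proof (intro sum.cong refl)
    fix v S assume "v \<in> strings d" "S \<in> \<S>"
    then show "c v / 2 ^ d * (\<Prod>i\<in>S. v ! (i - 1) * x (Q (take (i - 1) v))) =
        c v / 2 ^ d * (\<Prod>i\<in>S. v ! (i - 1)) * monomial (path_vars Q v S) x"
      using assms by (subst path_prod_eq[of n d]) auto
  qed
  then show ?thesis
    by (simp add: sum.cartesian_product)
qed

lemma fourier_coeff_tree_sum:
  assumes "valid_queries n d Q" "\<S> \<subseteq> Pow {1..d}" "A \<subseteq> {1..n}"
  shows "fourier_coeff n (tree_sum Q d \<S> c) A =
    (\<Sum>t | t \<in> strings d \<times> \<S> \<and> path_vars Q (fst t) (snd t) = A. c (fst t) / 2 ^ d * (\<Prod>i\<in>snd t. fst t ! (i - 1)))"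
proof -
  have fin: "finite (strings d \<times> \<S>)"
    by (intro finite_cartesian_product finite_strings finite_subset[OF assms(2)]) simp
  have sub: "path_vars Q (fst t) (snd t) \<subseteq> {1..n}" if "t \<in> strings d \<times> \<S>" for t
  proof -
    have "fst t \<in> strings d" "snd t \<in> \<S>"
      using that by auto
    then show ?thesis
      using assms(2) by (intro path_vars_subset[OF assms(1)]) blast+
  qed
  have "tree_sum Q d \<S> c = (\<lambda>x. \<Sum>t\<in>strings d \<times> \<S>. c (fst t) / 2 ^ d * (\<Prod>i\<in>snd t. fst t ! (i - 1)) *
      monomial (path_vars Q (fst t) (snd t)) x)"
    by (rule ext) (simp add: tree_sum_monomials[OF assms(1,2)] case_prod_unfold)
  then show ?thesis
    by (simp only: fourier_coeff_sum_monomial[OF sub assms(3) fin])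
qed

lemma nsets_subset_Pow: "nsets {1..d} k \<subseteq> Pow {1..d}"
  by (auto simp: nsets_def)

lemma fourier_coeff_level:
  assumes "A \<subseteq> {1..n}"
  shows "fourier_coeff n (fourier_level n k f) A = (if card A = k then fourier_coeff n f A else 0)"
proof -
  have "fourier_coeff n (fourier_level n k f) A = (\<Sum>S | S \<in> nsets {1..n} k \<and> S = A. fourier_coeff n f S)"
    using assms finite_subset[OF assms]
    by (subst fourier_coeff_sum_monomial[symmetric])
      (auto simp: fourier_level_def[abs_def] monomial_def[abs_def] finite_imp_finite_nsets dest: subsetD[OF nsets_subset_Pow])
  also have "\<dots> = (if card A = k then fourier_coeff n f A else 0)"
  proof -
    have "{S. S \<in> nsets {1..n} k \<and> S = A} = (if card A = k then {A} else {})"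
      using assms finite_subset[OF assms] by (auto simp: nsets_def)
    then show ?thesis by simp
  qed
  finally show ?thesis .
qed

text \<open>Queries along a path are distinct, so \<open>path_vars\<close> preserves cardinality,
  and choosing \<open>k\<close> levels amounts to taking the degree-\<open>k\<close> part. This
  makes the level inequality applicable to trees.\<close>

lemma fourier_norm_tree_sum_nsets:
  assumes "valid_queries n d (query T)"
  shows "fourier_norm n (tree_sum (query T) d (nsets {1..d} k) c) =
    fourier_norm n (fourier_level n k (\<lambda>x. c (path T x d)))"
proof -
  have "fourier_coeff n (tree_sum (query T) d (nsets {1..d} k) c) A
      = fourier_coeff n (fourier_level n k (\<lambda>x. c (path T x d))) A" if A: "A \<subseteq> {1..n}" for A
  proof -
    have "fourier_coeff n (\<lambda>x. c (path T x d)) A = fourier_coeff n (tree_sum (query T) d (Pow {1..d}) c) A"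
      by (rule fourier_coeff_cong) (simp add: tree_sum_Pow[OF _ assms])
    moreover have "{t. t \<in> strings d \<times> nsets {1..d} k \<and> path_vars (query T) (fst t) (snd t) = A} =
       (if card A = k then {t. t \<in> strings d \<times> Pow {1..d} \<and> path_vars (query T) (fst t) (snd t) = A} else {})"
      using card_path_vars[OF assms] by (auto simp: nsets_def dest: finite_subset[OF _ finite_atLeastAtMost])
    ultimately show ?thesis
      unfolding fourier_coeff_level[OF A] fourier_coeff_tree_sum[OF assms nsets_subset_Pow A]
      by (simp add: fourier_coeff_tree_sum[OF assms _ A])
  qed
  then show ?thesis
    by (simp add: fourier_norm_def)
qed

section \<open>Leaf densities and the level inequality\<close>

definition leaf_density :: "nat \<Rightarrow> (real list \<Rightarrow> real) \<Rightarrow> real" where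
  "leaf_density d c = real (card {v \<in> strings d. c v \<noteq> 0}) / 2 ^ d"

lemma leaf_density_bounds: "0 \<le> leaf_density d c" "leaf_density d c \<le> 1"
proof -
  have "card {v \<in> strings d. c v \<noteq> 0} \<le> card (strings d)"
    by (intro card_mono) auto
  then have "real (card {v \<in> strings d. c v \<noteq> 0}) \<le> 2 ^ d"
    using of_nat_mono[of _ "card (strings d)"] by (simp add: card_strings)
  then show "leaf_density d c \<le> 1"
    by (simp add: leaf_density_def)
qed (simp add: leaf_density_def)

text \<open>The probability is the Fourier coefficient at the empty set of the indicator of nonzero
  leaves, and only the empty level set contributes to it.\<close>

lemma nonzero_prob_path:
  assumes "valid_queries n d (query T)"
  shows "nonzero_prob n (\<lambda>x. c (path T x d)) = leaf_density d c"
proof -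
  define c' where "c' v = (if c v = 0 then 0 else 1 :: real)" for v
  have "nonzero_prob n (\<lambda>x. c (path T x d)) = (\<Sum>x\<in>cube n. c' (path T x d)) / 2 ^ n"
    by (simp add: nonzero_prob_def card_cube c'_def sum.If_cases Int_def)
  also have "\<dots> = fourier_coeff n (tree_sum (query T) d (Pow {1..d}) c') {}"
    unfolding fourier_coeff_def by (simp add: tree_sum_Pow[OF _ assms] cong: sum.cong)
  also have "\<dots> = (\<Sum>t\<in>strings d \<times> {{} :: nat set}. c' (fst t) / 2 ^ d)"
    unfolding fourier_coeff_tree_sum[OF assms order_refl empty_subsetI]
    by (rule sum.cong) (auto simp: path_vars_def)
  also have "\<dots> = (\<Sum>v\<in>strings d. c' v) / 2 ^ d"
    by (simp add: sum.cartesian_product' sum_divide_distrib)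
  also have "\<dots> = leaf_density d c"
    by (simp add: leaf_density_def c'_def sum.If_cases Int_def)
  finally show ?thesis .
qed

lemma ml_eval_const [simp]: "ml_eval (ml_const c) x = c"
  by (simp add: ml_eval_def ml_const_def)

text \<open>The bridge to \<open>level12_const\<close>. That property speaks of functions that are
  not identically zero, so density 0 is treated separately; both sides vanish there.\<close>

lemma level12_tree_sum:
  assumes "level12_const C" "n \<ge> 1" "valid_queries n d Q"
    and c: "\<forall>v\<in>strings d. c v \<in> {-1, 0, 1}" and k: "k \<in> {1, 2}"
  shows "fourier_norm n (tree_sum Q d (nsets {1..d} k) c)
    \<le> C ^ k * sqrt (real (d choose k)) * level_bound n k (leaf_density d c)"
proof (cases "leaf_density d c = 0")
  case True
  then have "c v = 0" if "v \<in> strings d" for v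
    using that by (auto simp: leaf_density_def card_eq_0_iff)
  then have "tree_sum Q d (nsets {1..d} k) c = (\<lambda>x. 0)"
    by (auto simp: tree_sum_def)
  then show ?thesis
    using True by (simp add: level_bound_def)
next
  case False
  define q where "q = leaf_density d c"
  have q: "0 < q" "q \<le> 1"
    using False leaf_density_bounds[of d c] by (auto simp: q_def)
  define T where "T = \<lparr>query = Q, leaf = (\<lambda>v. ml_const (c v))\<rparr>"
  have T [simp]: "query T = Q" "leaf T = (\<lambda>v. ml_const (c v))"
    by (auto simp: T_def)
  define g where "g x = c (path T x d)" for x
  have val: "valid_queries n d (query T)"
    using assms by simp
  have "nonzero_prob n g = q"
    unfolding g_def q_def by (rule nonzero_prob_path[OF val])
  moreover from this q have "card {x \<in> cube n. g x \<noteq> 0} \<noteq> 0"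
    unfolding nonzero_prob_def by (intro notI) simp
  then have "{x \<in> cube n. g x \<noteq> 0} \<noteq> {}"
    by (intro notI) simp
  then have "\<exists>x\<in>cube n. g x \<noteq> 0"
    by blast
  moreover have "computable n d g"
    unfolding computable_def
  proof (intro exI[of _ T] conjI)
    show "is_dtree n d T"
      using assms(3) by (auto simp: is_dtree_def valid_queries_def queried_def[abs_def] ml_const_def)
  qed (auto simp: g_def)
  moreover have "\<forall>x\<in>cube n. g x \<in> {-1, 0, 1}"
    unfolding g_def using c path_mem_strings[OF _ val order_refl] by blast
  ultimately have "fourier_norm n (fourier_level n 1 g) \<le> sqrt (real (d choose 1)) * C * q * sqrt (ln (exp 1 / q))"
     "fourier_norm n (fourier_level n 2 g)
            \<le> sqrt (real (d choose 2)) * C\<^sup>2 * q * sqrt (ln (exp 1 / q)) * sqrt (ln (exp 1 * real n / q))"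
    using assms(1)[unfolded level12_const_def, rule_format, OF \<open>n \<ge> 1\<close>, of g d q] by simp_all
  moreover have "ln (exp 1 / q) = 1 - ln q" "ln (exp 1 * real n / q) = 1 + ln (real n) - ln q"
    using q assms by (auto simp: ln_div ln_mult)
  ultimately have "fourier_norm n (fourier_level n k g) \<le> C ^ k * sqrt (real (d choose k)) * level_bound n k q"
    using k q by (auto simp: level_bound_def real_sqrt_mult ac_simps)
  moreover have "fourier_norm n (fourier_level n k g) = fourier_norm n (tree_sum Q d (nsets {1..d} k) c)"
    unfolding g_def using fourier_norm_tree_sum_nsets[OF val] by simp
  ultimately show ?thesis
    by (simp add: q_def)
qed

text \<open>\<open>f\<close> is from the start a combination of monomials of degree
  \<open>k\<close>, and collecting equal ones yields its Fourier coefficients. The expansion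
  therefore holds at every \<open>x\<close>, also off the cube.\<close>

lemma tree_sum_nsets_expand:
  fixes c :: "real list \<Rightarrow> real" and k :: nat
  assumes "valid_queries n d Q"
  defines "f \<equiv> tree_sum Q d (nsets {1..d} k) c"
  shows "f x = (\<Sum>A\<in>nsets {1..n} k. fourier_coeff n f A * monomial A x)"
proof -
  define F where "F = strings d \<times> nsets {1..d} k"
  define b where "b t = c (fst t) / 2 ^ d * (\<Prod>i\<in>snd t. fst t ! (i - 1))" for t
  define V where "V t = path_vars Q (fst t) (snd t)" for t
  have F: "finite F"
    by (simp add: F_def finite_imp_finite_nsets)
  have V: "V t \<in> nsets {1..n} k" if "t \<in> F" for t
  proof -
    have "fst t \<in> strings d" "snd t \<subseteq> {1..d}" "card (snd t) = k"
      using that by (auto simp: F_def nsets_def)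
    then have "V t \<subseteq> {1..n}" "card (V t) = k"
      unfolding V_def using path_vars_subset[OF assms(1)] card_path_vars[OF assms(1)] by simp_all
    then show ?thesis
      using finite_subset[of "V t" "{1..n}"] by (simp add: nsets_def)
  qed
  have "f x = (\<Sum>t\<in>F. b t * monomial (V t) x)"
    unfolding f_def F_def b_def V_def tree_sum_monomials[OF assms(1) nsets_subset_Pow]
    by (simp add: case_prod_unfold)
  also have "\<dots> = (\<Sum>A\<in>nsets {1..n} k. \<Sum>t | t \<in> F \<and> V t = A. b t * monomial (V t) x)"
    using F V by (intro sum.group[symmetric]) (auto intro: finite_imp_finite_nsets)
  also have "\<dots> = (\<Sum>A\<in>nsets {1..n} k. fourier_coeff n f A * monomial A x)"
  proof (rule sum.cong)
    fix A assume "A \<in> nsets {1..n} k"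
    then have A: "A \<subseteq> {1..n}"
      by (simp add: nsets_def)
    have "(\<Sum>t | t \<in> F \<and> V t = A. b t * monomial (V t) x) = (\<Sum>t | t \<in> F \<and> V t = A. b t) * monomial A x"
      unfolding sum_distrib_right by (intro sum.cong) auto
    then show "(\<Sum>t | t \<in> F \<and> V t = A. b t * monomial (V t) x) = fourier_coeff n f A * monomial A x"
      unfolding f_def fourier_coeff_tree_sum[OF assms(1) nsets_subset_Pow A] F_def V_def b_def by simp
  qed simp
  finally show ?thesis .
qed

lemma sum_nsets_le_fourier_norm: "(\<Sum>A\<in>nsets {1..n} k. \<bar>fourier_coeff n f A\<bar>) \<le> fourier_norm n f"
  unfolding fourier_norm_def using nsets_subset_Pow by (intro sum_mono2) auto

section \<open>Cutting a tree at a given depth\<close>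

lemma path_sum_append:
  assumes "\<S> \<subseteq> Pow {1..d}" "\<R> \<subseteq> Pow {1..e}" "length u = d"
  shows "path_sum Q (append_sets d \<S> \<R>) (u @ w) x
    = path_sum Q \<S> u x * path_sum (\<lambda>w. Q (u @ w)) \<R> w x"
proof -
  have "path_sum Q (append_sets d \<S> \<R>) (u @ w) x =
     (\<Sum>(S, R)\<in>\<S> \<times> \<R>. \<Prod>i\<in>S \<union> (+) d ` R. (u @ w) ! (i - 1) * x (Q (take (i - 1) (u @ w))))"
    unfolding path_sum_def append_sets_def
    by (subst sum.reindex[OF inj_on_append_sets[OF assms(1,2)]]) (simp add: case_prod_unfold o_def)
  also have "\<dots> = (\<Sum>(S, R)\<in>\<S> \<times> \<R>. (\<Prod>i\<in>S. u ! (i - 1) * x (Q (take (i - 1) u))) *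
      (\<Prod>i\<in>R. w ! (i - 1) * x (Q (u @ take (i - 1) w))))"
  proof (rule sum.cong, simp, clarify)
    fix S R assume "S \<in> \<S>" "R \<in> \<R>"
    then have SR: "S \<subseteq> {1..d}" "R \<subseteq> {1..e}"
      using assms by blast+
    then have fin: "finite S" "finite R"
      using finite_subset[OF _ finite_atLeastAtMost] by blast+
    have "(\<Prod>i\<in>S \<union> (+) d ` R. (u @ w) ! (i - 1) * x (Q (take (i - 1) (u @ w)))) =
       (\<Prod>i\<in>S. (u @ w) ! (i - 1) * x (Q (take (i - 1) (u @ w)))) *
       (\<Prod>i\<in>R. (u @ w) ! (d + i - 1) * x (Q (take (d + i - 1) (u @ w))))"
      using SR fin by (subst prod.union_disjoint) (force simp: prod.reindex)+
    also have "(\<Prod>i\<in>S. (u @ w) ! (i - 1) * x (Q (take (i - 1) (u @ w)))) =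
        (\<Prod>i\<in>S. u ! (i - 1) * x (Q (take (i - 1) u)))"
    proof (rule prod.cong)
      fix i assume "i \<in> S"
      then have "i - 1 < d" using SR(1) by fastforce
      then show "(u @ w) ! (i - 1) * x (Q (take (i - 1) (u @ w))) = u ! (i - 1) * x (Q (take (i - 1) u))"
        using assms by (simp add: nth_append)
    qed simp
    also have "(\<Prod>i\<in>R. (u @ w) ! (d + i - 1) * x (Q (take (d + i - 1) (u @ w)))) =
        (\<Prod>i\<in>R. w ! (i - 1) * x (Q (u @ take (i - 1) w)))"
    proof (rule prod.cong)
      fix i assume "i \<in> R"
      then have "d + i - 1 = d + (i - 1)" using SR(2) by fastforce
      then show "(u @ w) ! (d + i - 1) * x (Q (take (d + i - 1) (u @ w))) = w ! (i - 1) * x (Q (u @ take (i - 1) w))"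
        using assms by (simp add: nth_append)
    qed simp
    finally show "(\<Prod>i\<in>S \<union> (+) d ` R. (u @ w) ! (i - 1) * x (Q (take (i - 1) (u @ w)))) =
       (\<Prod>i\<in>S. u ! (i - 1) * x (Q (take (i - 1) u))) * (\<Prod>i\<in>R. w ! (i - 1) * x (Q (u @ take (i - 1) w)))" .
  qed
  also have "\<dots> = path_sum Q \<S> u x * path_sum (\<lambda>w. Q (u @ w)) \<R> w x"
    by (simp add: path_sum_def sum_product sum.cartesian_product)
  finally show ?thesis .
qed

text \<open>The leaves below a node \<open>u\<close> combine to the polynomial of the subtree at
  \<open>u\<close>, while the levels above the cut give a cofactor that depends on \<open>u\<close>
  alone.\<close>

lemma tree_sum_append:
  assumes "\<S> \<subseteq> Pow {1..d}" "\<R> \<subseteq> Pow {1..e}"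
  shows "tree_sum Q (d + e) (append_sets d \<S> \<R>) c x = (\<Sum>u\<in>strings d.
     tree_sum (\<lambda>w. Q (u @ w)) e \<R> (\<lambda>w. c (u @ w)) x * (path_sum Q \<S> u x / 2 ^ d))"
  unfolding tree_sum_def sum_strings_append sum_distrib_right
  by (intro sum.cong refl) (simp add: path_sum_append[OF assms length_strings] power_add ac_simps)

lemma leaf_density_append:
  "leaf_density (d + e) c = (\<Sum>u\<in>strings d. leaf_density e (\<lambda>w. c (u @ w))) / real (card (strings d))"
proof -
  have density: "leaf_density d c = (\<Sum>v\<in>strings d. if c v = 0 then 0 else 1) / 2 ^ d" for d c
    by (simp add: leaf_density_def sum.If_cases Int_def)
  show ?thesis
    unfolding density sum_strings_append by (simp add: card_strings power_add sum_divide_distrib mult.commute)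
qed

subsection \<open>The induction over the intervals\<close>

text \<open>Bounds the number of monomials of degree \<open>k\<close> by the first parameter of
  \<open>Lam\<close>.\<close>

lemma binomial_le_square:
  assumes "k \<le> 2" "n \<ge> 1"
  shows "n choose k \<le> n\<^sup>2"
proof (cases "k \<le> n")
  case True
  then have "n choose k \<le> n ^ k"
    by (rule binomial_le_pow)
  also have "\<dots> \<le> n\<^sup>2"
    using assms by (intro power_increasing)
  finally show ?thesis .
qed (simp add: binomial_eq_0)

text \<open>On the nodes whose leaf polynomials have norm at most M, convexity reduces to leaves that are
  signed monomials; sorting them by the monomial leaves at most \<open>n\<^sup>2\<close> trees with signs at
  the leaves, whose densities add up to r.\<close>

lemma fourier_norm_group_le:
  fixes G :: "'u \<Rightarrow> (nat \<Rightarrow> real) \<Rightarrow> real"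
  assumes "n \<ge> 1" "k \<in> {1, 2}" "j \<ge> 1" "finite U" "V \<subseteq> U" "0 \<le> M" "0 \<le> B"
    and a: "\<And>v. v \<in> V \<Longrightarrow> (\<Sum>A\<in>nsets {1..n} k. \<bar>a v A\<bar>) \<le> M"
    and IH: "\<And>\<epsilon>. \<forall>u\<in>U. \<epsilon> u \<in> {-1, 0, 1 :: real} \<Longrightarrow> fourier_norm n (\<lambda>x. \<Sum>u\<in>U. \<epsilon> u * G u x)
      \<le> B * Lam (n\<^sup>2) j (real (card {u \<in> U. \<epsilon> u \<noteq> 0}) / real (card U))"
  defines "r \<equiv> real (card V) / real (card U)"
  shows "fourier_norm n (\<lambda>x. \<Sum>v\<in>V. (\<Sum>A\<in>nsets {1..n} k. a v A * monomial A x) * G v x)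
    \<le> M * (B * (r * log_pow j (real j + real j * ln (real (n\<^sup>2))) r))"
proof -
  define \<A> where "\<A> = nsets {1..n} k"
  have fin: "finite \<A>" "finite V"
    using assms finite_subset by (auto simp: \<A>_def finite_imp_finite_nsets)
  have \<A>: "A \<subseteq> {1..n}" if "A \<in> \<A>" for A
    using that by (auto simp: \<A>_def nsets_def)
  have r: "r \<le> 1"
    unfolding r_def using card_mono[OF \<open>finite U\<close> \<open>V \<subseteq> U\<close>]
    by (cases "card U = 0") (auto simp: divide_le_eq_1)
  show ?thesis
  proof (cases "M = 0")
    case True
    have "a v A = 0" if "v \<in> V" "A \<in> \<A>" for v A
    proof -
      have "(\<Sum>A\<in>\<A>. \<bar>a v A\<bar>) = 0"
        using a[OF that(1)] True by (intro antisym sum_nonneg) (auto simp: \<A>_def)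
      then show ?thesis
        using fin that by (simp add: sum_nonneg_eq_0_iff)
    qed
    then show ?thesis
      using True by (simp flip: \<A>_def)
  next
    case False
    with assms have M: "M > 0" by simp
    define X where "X v A x = monomial A x * G v x" for v A x
    \<comment> \<open>Division by \<open>M\<close> brings the coefficients of every node into the
      unit ball.\<close>
    have "fourier_norm n (\<lambda>x. 0 + (\<Sum>v\<in>V. \<Sum>A\<in>\<A>. a v A / M * X v A x))
      \<le> B * (r * log_pow j (real j + real j * ln (real (n\<^sup>2))) r)"
    proof (rule fourier_norm_extreme)
      fix v assume "v \<in> V"
      then show "(\<Sum>A\<in>\<A>. \<bar>a v A / M\<bar>) \<le> 1"
        using a[of v] M by (simp add: \<A>_def flip: sum_divide_distrib)
    next
      fix \<epsilon> :: "'u \<Rightarrow> real" and \<sigma>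
      assume vertex: "\<And>v. v \<in> V \<Longrightarrow> \<epsilon> v \<in> {-1, 0, 1} \<and> (\<epsilon> v \<noteq> 0 \<longrightarrow> \<sigma> v \<in> \<A>)"
      define W where "W = {v \<in> V. \<epsilon> v \<noteq> 0}"
      have W: "finite W" "W \<subseteq> U" "\<sigma> ` W \<subseteq> \<A>"
        using fin vertex assms by (auto simp: W_def)
      \<comment> \<open>\<open>\<delta> A\<close> keeps the signs of the nodes whose vertex is the
        monomial \<open>A\<close> and is 0 elsewhere; it is a labelling to which \<open>IH\<close>
        applies.\<close>
      define \<delta> where "\<delta> A u = (if u \<in> W \<and> \<sigma> u = A then \<epsilon> u else 0)" for A u
      define p where "p A = real (card {u \<in> W. \<sigma> u = A}) / real (card U)" for A
      have nz: "{u \<in> U. \<delta> A u \<noteq> 0} = {u \<in> W. \<sigma> u = A}" for A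
        using W by (auto simp: \<delta>_def W_def)
      have \<delta>: "(\<Sum>u | u \<in> W \<and> \<sigma> u = A. \<epsilon> u * G u x) = (\<Sum>u\<in>U. \<delta> A u * G u x)" for A x
        using W \<open>finite U\<close> by (intro sum.mono_neutral_cong_left) (auto simp: \<delta>_def)
      have "(\<Sum>v\<in>V. \<epsilon> v * X v (\<sigma> v) x) = (\<Sum>A\<in>\<A>. monomial A x * (\<Sum>u\<in>U. \<delta> A u * G u x))" for x
      proof -
        have "(\<Sum>v\<in>V. \<epsilon> v * X v (\<sigma> v) x) = (\<Sum>v\<in>W. \<epsilon> v * X v (\<sigma> v) x)"
          using fin by (intro sum.mono_neutral_right) (auto simp: W_def)
        also have "\<dots> = (\<Sum>A\<in>\<A>. \<Sum>u | u \<in> W \<and> \<sigma> u = A. \<epsilon> u * X u (\<sigma> u) x)"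
          using W fin by (intro sum.group[symmetric]) auto
        also have "\<dots> = (\<Sum>A\<in>\<A>. monomial A x * (\<Sum>u | u \<in> W \<and> \<sigma> u = A. \<epsilon> u * G u x))"
          unfolding sum_distrib_left by (intro sum.cong refl) (auto simp: X_def)
        finally show ?thesis
          unfolding \<delta> .
      qed
      then have "fourier_norm n (\<lambda>x. 0 + (\<Sum>v\<in>V. \<epsilon> v * X v (\<sigma> v) x))
          = fourier_norm n (\<lambda>x. \<Sum>A\<in>\<A>. monomial A x * (\<Sum>u\<in>U. \<delta> A u * G u x))"
        by simp
      also have "\<dots> \<le> (\<Sum>A\<in>\<A>. fourier_norm n (\<lambda>x. monomial A x * (\<Sum>u\<in>U. \<delta> A u * G u x)))"
        by (rule fourier_norm_sum)
      also have "\<dots> = (\<Sum>A\<in>\<A>. fourier_norm n (\<lambda>x. \<Sum>u\<in>U. \<delta> A u * G u x))"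
        using \<A> by (intro sum.cong fourier_norm_monomial_mult) auto
      also have "\<dots> \<le> (\<Sum>A\<in>\<A>. B * Lam (n\<^sup>2) j (p A))"
      proof (rule sum_mono)
        fix A
        have "\<forall>u\<in>U. \<delta> A u \<in> {-1, 0, 1}"
          using vertex by (auto simp: \<delta>_def W_def)
        from IH[OF this] show "fourier_norm n (\<lambda>x. \<Sum>u\<in>U. \<delta> A u * G u x) \<le> B * Lam (n\<^sup>2) j (p A)"
          by (simp add: nz p_def)
      qed
      also have "\<dots> = B * (\<Sum>A\<in>\<A>. Lam (n\<^sup>2) j (p A))"
        by (simp add: sum_distrib_left)
      \<comment> \<open>The node sets for different \<open>A\<close> are disjoint, so the densities
        \<open>p A\<close> add up to at most \<open>r\<close>.\<close>
      also have "\<dots> \<le> B * (r * log_pow j (real j + real j * ln (real (n\<^sup>2))) r)"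
      proof (intro mult_left_mono sum_Lam_le)
        show "card \<A> \<le> n\<^sup>2"
          using binomial_le_square[of k n] assms by (auto simp: \<A>_def)
        have "(\<Sum>A\<in>\<A>. card {u \<in> W. \<sigma> u = A}) = card W"
          using W fin sum.group[of W \<A> \<sigma> "\<lambda>_. 1::nat"] by simp
        also have "\<dots> \<le> card V"
          using fin by (intro card_mono) (auto simp: W_def)
        finally have "real (\<Sum>A\<in>\<A>. card {u \<in> W. \<sigma> u = A}) \<le> real (card V)"
          by (rule of_nat_mono)
        then show "(\<Sum>A\<in>\<A>. p A) \<le> r"
          by (simp add: p_def r_def divide_right_mono flip: sum_divide_distrib)
      qed (use assms fin r in \<open>auto simp: p_def\<close>)
      finally show "fourier_norm n (\<lambda>x. 0 + (\<Sum>v\<in>V. \<epsilon> v * X v (\<sigma> v) x))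
          \<le> B * (r * log_pow j (real j + real j * ln (real (n\<^sup>2))) r)" .
    qed (use fin in auto)
    then have "M * fourier_norm n (\<lambda>x. \<Sum>v\<in>V. \<Sum>A\<in>\<A>. a v A / M * X v A x)
      \<le> M * (B * (r * log_pow j (real j + real j * ln (real (n\<^sup>2))) r))"
      using M by simp
    moreover have "M * fourier_norm n (\<lambda>x. \<Sum>v\<in>V. \<Sum>A\<in>\<A>. a v A / M * X v A x)
        = fourier_norm n (\<lambda>x. M * (\<Sum>v\<in>V. \<Sum>A\<in>\<A>. a v A / M * X v A x))"
      unfolding fourier_norm_scale using M by simp
    moreover have "(\<lambda>x. M * (\<Sum>v\<in>V. \<Sum>A\<in>\<A>. a v A / M * X v A x)) =
        (\<lambda>x. \<Sum>v\<in>V. (\<Sum>A\<in>\<A>. a v A * monomial A x) * G v x)"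
      using M by (simp add: X_def sum_distrib_left sum_distrib_right mult.assoc)
    ultimately show ?thesis
      by (simp add: \<A>_def)
  qed
qed

lemma sum_level_bound_le:
  assumes "n \<ge> 1" "k \<in> {1, 2}" "j \<ge> 1" "N \<le> n"
    and r: "\<And>s. s < N \<Longrightarrow> 0 \<le> r s \<and> r s \<le> 1"
    and "(\<Sum>s<N. (1 / 2) ^ s * r s) \<le> 2 * p"
    and "(\<Sum>s<N. level_bound n k ((1 / 2) ^ s) * r s) \<le> 2 * level_bound n k p"
    and "0 < p" "p \<le> 1"
  shows "(\<Sum>s<N. level_bound n k ((1 / 2) ^ s) * (r s * log_pow j (real j + real j * ln (real (n\<^sup>2))) (r s)))
    \<le> 12 * Lam (n\<^sup>2) (j + k) p"
proof (cases "p \<le> 1 / real (n\<^sup>2)")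
  case True
  then show ?thesis
    using assms by (intro sum_level_bound_le_small) auto
next
  case False
  then show ?thesis
    using assms by (intro sum_level_bound_le_large) auto
qed

text \<open>\<open>G u\<close> stands for the cofactor from above the cut, \<open>q u\<close> for
  the density below the node \<open>u\<close>, and \<open>IH\<close> for the bound on the truncated
  tree with any signs at its leaves. The condition \<open>e < n\<close> keeps the
  \<open>e + 1\<close> scales within the \<open>n\<close> that the summation allows.\<close>

lemma fourier_norm_step:
  fixes G :: "'u \<Rightarrow> (nat \<Rightarrow> real) \<Rightarrow> real" and q :: "'u \<Rightarrow> real"
  assumes n: "n \<ge> 1" "k \<in> {1, 2}" "j \<ge> 1" "e < n" and U: "finite U" and B: "0 \<le> B" "0 \<le> D"
    and q: "\<And>u. u \<in> U \<Longrightarrow> q u \<le> 1 \<and> (q u = 0 \<or> (1 / 2) ^ e \<le> q u)"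
    and a: "\<And>u. u \<in> U \<Longrightarrow> (\<Sum>A\<in>nsets {1..n} k. \<bar>a u A\<bar>) \<le> D * level_bound n k (q u)"
    and IH: "\<And>\<epsilon>. \<forall>u\<in>U. \<epsilon> u \<in> {-1, 0, 1 :: real} \<Longrightarrow> fourier_norm n (\<lambda>x. \<Sum>u\<in>U. \<epsilon> u * G u x)
      \<le> B * Lam (n\<^sup>2) j (real (card {u \<in> U. \<epsilon> u \<noteq> 0}) / real (card U))"
  shows "fourier_norm n (\<lambda>x. \<Sum>u\<in>U. (\<Sum>A\<in>nsets {1..n} k. a u A * monomial A x) * G u x)
    \<le> 12 * B * D * Lam (n\<^sup>2) (j + k) ((\<Sum>u\<in>U. q u) / real (card U))"
proof -
  define P where "P u x = (\<Sum>A\<in>nsets {1..n} k. a u A * monomial A x) * G u x" for u x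
  define p where "p = (\<Sum>u\<in>U. q u) / real (card U)"
  \<comment> \<open>Nodes of density 0 belong to no dyadic scale; their coefficients vanish by
    \<open>a\<close>, so they are dropped.\<close>
  define W where "W = {u \<in> U. q u \<noteq> 0}"
  have W: "finite W" "W \<subseteq> U"
    using U by (auto simp: W_def)
  have q01: "0 \<le> q u \<and> q u \<le> 1" if "u \<in> U" for u
  proof -
    have "0 < (1 / 2 :: real) ^ e" by simp
    then show ?thesis
      using q[OF that] by linarith
  qed
  have a0: "a u A = 0" if "u \<in> U - W" "A \<in> nsets {1..n} k" for u A
  proof -
    have "(\<Sum>A\<in>nsets {1..n} k. \<bar>a u A\<bar>) = 0"
      using a[of u] that by (intro antisym sum_nonneg) (auto simp: W_def level_bound_def)
    then show ?thesis
      using that by (simp add: sum_nonneg_eq_0_iff finite_imp_finite_nsets)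
  qed
  have PW: "(\<Sum>u\<in>U. P u x) = (\<Sum>u\<in>W. P u x)" for x
    using U W a0 by (intro sum.mono_neutral_right) (auto simp: P_def)
  have qW: "(\<Sum>u\<in>U. q u) = (\<Sum>u\<in>W. q u)"
    using U by (intro sum.mono_neutral_right) (auto simp: W_def)
  show ?thesis
  proof (cases "W = {}")
    case True
    then show ?thesis
      unfolding P_def[symmetric] PW qW by (simp add: Lam_def)
  next
    case False
    have cU: "0 < real (card U)"
      using False W U by (auto simp: card_gt_0_iff)
    have "\<forall>u\<in>W. \<exists>s\<le>e. q u \<le> (1 / 2) ^ s \<and> (1 / 2) ^ Suc s < q u"
      using q W by (intro ballI scale_exists) (auto simp: W_def)
    then obtain s where s: "\<And>u. u \<in> W \<Longrightarrow> s u \<le> e \<and> q u \<le> (1 / 2) ^ s u \<and> (1 / 2) ^ Suc (s u) < q u"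
      by metis
    have group: "(\<Sum>t<Suc e. \<Sum>u | u \<in> W \<and> s u = t. f u) = (\<Sum>u\<in>W. f u)" for f :: "'u \<Rightarrow> real"
      using W s by (intro sum.group) (auto simp: less_Suc_eq_le)
    define r where "r t = real (card {u \<in> W. s u = t}) / real (card U)" for t
    have p: "0 < p" "p \<le> 1"
    proof -
      have "0 < (\<Sum>u\<in>W. q u)"
        using False W q01 by (intro sum_pos) (force simp: W_def)+
      then show "0 < p"
        using cU by (simp add: p_def qW)
      have "(\<Sum>u\<in>U. q u) \<le> (\<Sum>u\<in>U. 1)"
        using q01 by (intro sum_mono) auto
      then show "p \<le> 1"
        using cU by (simp add: p_def divide_le_eq)
    qed
    define M where "M t = D * level_bound n k ((1 / 2) ^ t)" for t
    have lb: "0 \<le> level_bound n k ((1 / 2) ^ t)" for t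
      using n by (intro level_bound_nonneg) (auto simp: power_le_one)
    have "fourier_norm n (\<lambda>x. \<Sum>u\<in>U. P u x) = fourier_norm n (\<lambda>x. \<Sum>t<Suc e. \<Sum>u | u \<in> W \<and> s u = t. P u x)"
      unfolding PW group ..
    also have "\<dots> \<le> (\<Sum>t<Suc e. fourier_norm n (\<lambda>x. \<Sum>u | u \<in> W \<and> s u = t. P u x))"
      by (rule fourier_norm_sum)
    also have "\<dots> \<le> (\<Sum>t<Suc e. M t * (B * (r t * log_pow j (real j + real j * ln (real (n\<^sup>2))) (r t))))"
      unfolding P_def r_def
    proof (intro sum_mono fourier_norm_group_le)
      fix t u assume "u \<in> {u \<in> W. s u = t}"
      then have u: "u \<in> W" "s u = t" by auto
      have "level_bound n k (q u) \<le> level_bound n k ((1 / 2) ^ t)"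
        using s[OF u(1)] u q01 W n by (intro level_bound_mono) (auto simp: power_le_one)
      then have "D * level_bound n k (q u) \<le> M t"
        unfolding M_def using B by (intro mult_left_mono)
      moreover have "(\<Sum>A\<in>nsets {1..n} k. \<bar>a u A\<bar>) \<le> D * level_bound n k (q u)"
        using u W by (intro a) auto
      ultimately show "(\<Sum>A\<in>nsets {1..n} k. \<bar>a u A\<bar>) \<le> M t"
        by linarith
    qed (use n U B W IH lb in \<open>auto simp: M_def\<close>)
    also have "\<dots> = B * D * (\<Sum>t<Suc e. level_bound n k ((1 / 2) ^ t) *
        (r t * log_pow j (real j + real j * ln (real (n\<^sup>2))) (r t)))"
      unfolding sum_distrib_left M_def by (intro sum.cong) (auto simp: ac_simps)
    also have "\<dots> \<le> B * D * (12 * Lam (n\<^sup>2) (j + k) p)"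
    proof (intro mult_left_mono sum_level_bound_le)
      fix t
      have "card {u \<in> W. s u = t} \<le> card U"
        using U W by (intro card_mono) auto
      then show "0 \<le> r t \<and> r t \<le> 1"
        using cU by (simp add: r_def divide_le_eq)
    next
      have "(\<Sum>t<Suc e. (1 / 2) ^ t * r t) = (\<Sum>t<Suc e. \<Sum>u | u \<in> W \<and> s u = t. (1 / 2) ^ s u) / real (card U)"
        unfolding sum_divide_distrib by (intro sum.cong) (auto simp: r_def)
      also have "\<dots> = (\<Sum>u\<in>W. (1 / 2) ^ s u) / real (card U)"
        by (simp only: group)
      \<comment> \<open>By the choice of the scale, \<open>(1 / 2) ^ s u\<close> is less than
        \<open>2 * q u\<close>.\<close>
      also have "\<dots> \<le> (\<Sum>u\<in>W. 2 * q u) / real (card U)"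
        using s cU by (intro divide_right_mono sum_mono) fastforce+
      also have "\<dots> = 2 * p"
        by (simp add: p_def qW flip: sum_distrib_left)
      finally show "(\<Sum>t<Suc e. (1 / 2) ^ t * r t) \<le> 2 * p" .
    next
      have "(\<Sum>t<Suc e. level_bound n k ((1 / 2) ^ t) * r t)
          = (\<Sum>t<Suc e. \<Sum>u | u \<in> W \<and> s u = t. level_bound n k ((1 / 2) ^ s u)) / real (card U)"
        unfolding sum_divide_distrib by (intro sum.cong) (auto simp: r_def)
      also have "\<dots> = (\<Sum>u\<in>W. level_bound n k ((1 / 2) ^ s u)) / real (card U)"
        by (simp only: group)
      also have "\<dots> \<le> (\<Sum>u\<in>W. 2 * level_bound n k (q u)) / real (card U)"
        using s cU n by (intro divide_right_mono sum_mono level_bound_dyadic_le) auto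
      also have "(\<Sum>u\<in>W. 2 * level_bound n k (q u)) = 2 * (\<Sum>u\<in>U. level_bound n k (q u))"
        unfolding sum_distrib_left using U by (intro sum.mono_neutral_left) (auto simp: W_def level_bound_def)
      \<comment> \<open>Jensen over all of \<open>U\<close>: the mean of \<open>q\<close> is
        \<open>p\<close> only when nodes of density 0 are counted.\<close>
      also have "2 * (\<Sum>u\<in>U. level_bound n k (q u)) / real (card U)
          \<le> 2 * (real (card U) * level_bound n k p) / real (card U)"
        using U n q01 p by (intro divide_right_mono mult_left_mono level_bound_Jensen[OF _ _ _ p_def]) auto
      also have "\<dots> = 2 * level_bound n k p"
        using cU by simp
      finally show "(\<Sum>t<Suc e. level_bound n k ((1 / 2) ^ t) * r t) \<le> 2 * level_bound n k p" .
    qed (use n B p in auto)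
    finally show ?thesis
      by (simp add: P_def p_def ac_simps)
  qed
qed

text \<open>A density at depth \<open>d\<close> is an integer multiple of
  \<open>(1 / 2) ^ d\<close>.\<close>

lemma leaf_density_cases: "leaf_density d c = 0 \<or> (1 / 2) ^ d \<le> leaf_density d c"
proof (cases "card {v \<in> strings d. c v \<noteq> 0} = 0")
  case True
  then show ?thesis by (simp only: leaf_density_def) simp
next
  case False
  then have "1 \<le> real (card {v \<in> strings d. c v \<noteq> 0})"
    by linarith
  then have "1 / 2 ^ d \<le> leaf_density d c"
    unfolding leaf_density_def by (intro divide_right_mono) auto
  then show ?thesis
    by (simp add: power_one_over)
qed

text \<open>The induction ranges over all depths and labellings, since the hypothesis is applied to
  the truncated tree with arbitrary signs at its new leaves. Nonempty intervals ensure that the cut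
  lies at a positive depth.\<close>

lemma blocks_bound:
  assumes C: "C \<ge> 1" "level12_const C" and "n \<ge> 1"
    and "finite J" "card J = Suc t"
    and "\<forall>i\<in>J. is_interval_nat (I i) \<and> I i \<noteq> {} \<and> k i \<in> {1, 2}"
    and "disjoint_family_on I J" "(\<Union>i\<in>J. I i) = {1..d}"
    and "valid_queries n d Q" "\<forall>v\<in>strings d. c v \<in> {-1, 0, 1}"
  shows "fourier_norm n (tree_sum Q d (blocks I k J) c) \<le>
    2 * C ^ (\<Sum>i\<in>J. k i) * 12 ^ t * Lam (n\<^sup>2) (\<Sum>i\<in>J. k i) (leaf_density d c) *
    (\<Prod>i\<in>J. sqrt (real (card (I i) choose k i)))"
  using assms(4-)
proof (induction t arbitrary: J d c)
  case 0
  then obtain j where J: "J = {j}"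
    by (metis One_nat_def card_1_singletonE)
  with 0 have j: "I j = {1..d}" "k j \<in> {1, 2}"
    by auto
  have "blocks I k J = nsets {1..d} (k j)"
    unfolding blocks_def nsets_def J using j(1)
    by (auto simp: Int_absorb2 dest: finite_subset[OF _ finite_atLeastAtMost])
  then have "fourier_norm n (tree_sum Q d (blocks I k J) c)
      \<le> C ^ k j * sqrt (real (d choose k j)) * level_bound n (k j) (leaf_density d c)"
    using level12_tree_sum[OF C(2) \<open>n \<ge> 1\<close>] 0 j by simp
  also have "\<dots> \<le> C ^ k j * sqrt (real (d choose k j)) * (2 * Lam (n\<^sup>2) (k j) (leaf_density d c))"
    using C \<open>n \<ge> 1\<close> j leaf_density_bounds
    by (intro mult_left_mono level_bound_le_Lam) auto
  finally show ?case
    using j by (simp add: J ac_simps)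
next
  case (Suc t)
  have ne: "I i \<noteq> {}" if "i \<in> J" for i
    using Suc.prems that by blast
  have "J \<noteq> {}"
    using Suc.prems by auto
  \<comment> \<open>The interval to be cut off is the one containing the deepest level
    \<open>d\<close>.\<close>
  then have "d \<in> {1..d}"
    using ne Suc.prems(5) by fastforce
  then obtain j where j: "j \<in> J" "d \<in> I j"
    using Suc.prems(5) by blast
  obtain a b where ab: "I j = {a..b}"
    using Suc.prems(3) j by (auto simp: is_interval_nat_def)
  have "I j \<subseteq> {1..d}"
    using Suc.prems(5) j by blast
  moreover have "a \<in> I j" "b \<in> I j" "a \<le> d" "d \<le> b"
    using j unfolding ab by auto
  ultimately have "a \<ge> 1" "a \<le> d" "b = d"
    by fastforce+
  define d' where "d' = a - 1"
  define e where "e = d - d'"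
  have de: "d = d' + e" "I j = {d' + 1..d' + e}"
    using \<open>a \<ge> 1\<close> \<open>a \<le> d\<close> \<open>b = d\<close> ab by (auto simp: d'_def e_def)
  have kj: "k j \<in> {1, 2}" and card_Ij: "card (I j) = e"
    using Suc.prems(3) j de by auto
  define J' where "J' = J - {j}"
  have J': "finite J'" "card J' = Suc t" "J = insert j J'" "j \<notin> J'"
    using Suc.prems j by (auto simp: J'_def)
  have disj: "disjoint_family_on I J'"
    using Suc.prems unfolding J'_def by (auto simp: disjoint_family_on_def)
  have "(\<Union>i\<in>J'. I i) \<inter> I j = {}"
    using disjoint_family_onD[OF Suc.prems(4) _ j(1)] by (fastforce simp: J'_def)
  moreover have "(\<Union>i\<in>J'. I i) \<union> I j = {1..d}"
    using Suc.prems(5) unfolding J'(3) by blast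
  ultimately have "(\<Union>i\<in>J'. I i) = {1..d} - I j"
    by blast
  then have un: "(\<Union>i\<in>J'. I i) = {1..d'}"
    unfolding de by auto
  obtain i where "i \<in> J'"
    using J'(2) by fastforce
  \<comment> \<open>A further interval lies above the cut, so that
    \<open>e < d <= n\<close>.\<close>
  then have "d' \<ge> 1"
    using un ne[of i] J'(3) by fastforce
  have val: "valid_queries n (d' + e) Q"
    using Suc.prems(6) de(1) by simp
  have en: "e < n"
    using valid_queries_le[OF val] \<open>d' \<ge> 1\<close> by simp
  define K where "K = (\<Sum>i\<in>J'. k i)"
  have K: "(\<Sum>i\<in>J. k i) = K + k j" "K \<ge> 1"
  proof -
    show "(\<Sum>i\<in>J. k i) = K + k j"
      using J' by (simp add: K_def)
    have "k i \<le> K"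
      unfolding K_def using \<open>i \<in> J'\<close> J' by (intro member_le_sum) auto
    moreover have "k i \<ge> 1"
      using Suc.prems(3) \<open>i \<in> J'\<close> unfolding J'(3) by auto
    ultimately show "K \<ge> 1" by linarith
  qed
  define R where "R = (\<Prod>i\<in>J'. sqrt (real (card (I i) choose k i)))"
  have R: "R \<ge> 0"
    by (simp add: R_def prod_nonneg)
  \<comment> \<open>\<open>f u\<close> is the polynomial of the subtree at \<open>u\<close> on the
    last interval, \<open>G u\<close> its cofactor.\<close>
  define f where "f u = tree_sum (\<lambda>w. Q (u @ w)) e (nsets {1..e} (k j)) (\<lambda>w. c (u @ w))" for u
  define G where "G u x = path_sum Q (blocks I k J') u x / 2 ^ d'" for u x
  have valu: "valid_queries n e (\<lambda>w. Q (u @ w))" if "u \<in> strings d'" for u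
    using valid_queries_subtree[OF val that] .
  have blocks_sub: "blocks I k J' \<subseteq> Pow {1..d'}"
    using un by (auto simp: blocks_def)
  have eq: "blocks I k J = append_sets d' (blocks I k J') (nsets {1..e} (k j))"
    unfolding J'_def by (intro blocks_eq_append_sets) (use j de un in \<open>auto simp: J'_def\<close>)
  have "fourier_norm n (tree_sum Q d (blocks I k J) c) =
     fourier_norm n (\<lambda>x. \<Sum>u\<in>strings d'. (\<Sum>A\<in>nsets {1..n} (k j). fourier_coeff n (f u) A * monomial A x) * G u x)"
  proof (rule fourier_norm_cong)
    fix x
    have "tree_sum Q d (blocks I k J) c x = (\<Sum>u\<in>strings d'. f u x * G u x)"
      unfolding eq de(1) f_def G_def by (rule tree_sum_append[OF blocks_sub nsets_subset_Pow])
    also have "\<dots> = (\<Sum>u\<in>strings d'. (\<Sum>A\<in>nsets {1..n} (k j). fourier_coeff n (f u) A * monomial A x) * G u x)"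
      unfolding f_def by (intro sum.cong refl arg_cong2[where f = "(*)"] tree_sum_nsets_expand valu)
    finally show "tree_sum Q d (blocks I k J) c x = \<dots>" .
  qed
  also have "\<dots> \<le> 12 * (2 * C ^ K * 12 ^ t * R) * (C ^ k j * sqrt (real (e choose k j))) *
      Lam (n\<^sup>2) (K + k j) ((\<Sum>u\<in>strings d'. leaf_density e (\<lambda>w. c (u @ w))) / real (card (strings d')))"
  proof (rule fourier_norm_step[OF \<open>n \<ge> 1\<close> kj K(2) en finite_strings])
    fix u assume u: "u \<in> strings d'"
    show "leaf_density e (\<lambda>w. c (u @ w)) \<le> 1 \<and>
        (leaf_density e (\<lambda>w. c (u @ w)) = 0 \<or> (1 / 2) ^ e \<le> leaf_density e (\<lambda>w. c (u @ w)))"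
      using leaf_density_bounds leaf_density_cases by auto
    have "\<forall>w\<in>strings e. c (u @ w) \<in> {-1, 0, 1}"
      using Suc.prems(7) u strings_append_iff[OF length_strings[OF u]] unfolding de(1) by blast
    from order_trans[OF sum_nsets_le_fourier_norm level12_tree_sum[OF C(2) \<open>n \<ge> 1\<close> valu[OF u] this kj]]
    show "(\<Sum>A\<in>nsets {1..n} (k j). \<bar>fourier_coeff n (f u) A\<bar>)
        \<le> C ^ k j * sqrt (real (e choose k j)) * level_bound n (k j) (leaf_density e (\<lambda>w. c (u @ w)))"
      unfolding f_def .
  next
    \<comment> \<open>Signs on the nodes at depth \<open>d'\<close> are leaf labels of the truncated
      tree.\<close>
    fix \<epsilon> :: "real list \<Rightarrow> real" assume "\<forall>u\<in>strings d'. \<epsilon> u \<in> {-1, 0, 1}"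
    moreover have "\<forall>i\<in>J'. is_interval_nat (I i) \<and> I i \<noteq> {} \<and> k i \<in> {1, 2}"
      using Suc.prems(3) J'(3) by blast
    ultimately have "fourier_norm n (tree_sum Q d' (blocks I k J') \<epsilon>) \<le>
      2 * C ^ K * 12 ^ t * Lam (n\<^sup>2) K (leaf_density d' \<epsilon>) * R"
      unfolding K_def R_def using J' disj un valid_queries_prefix[OF val] by (intro Suc.IH)
    moreover have "tree_sum Q d' (blocks I k J') \<epsilon> = (\<lambda>x. \<Sum>u\<in>strings d'. \<epsilon> u * G u x)"
      by (rule ext) (simp add: tree_sum_def G_def)
    ultimately show "fourier_norm n (\<lambda>x. \<Sum>u\<in>strings d'. \<epsilon> u * G u x) \<le> 2 * C ^ K * 12 ^ t * R *
        Lam (n\<^sup>2) K (real (card {u \<in> strings d'. \<epsilon> u \<noteq> 0}) / real (card (strings d')))"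
      by (simp add: leaf_density_def card_strings ac_simps)
  qed (use C R in auto)
  also have "(\<Sum>u\<in>strings d'. leaf_density e (\<lambda>w. c (u @ w))) / real (card (strings d')) = leaf_density d c"
    unfolding de(1) by (rule leaf_density_append[symmetric])
  also have "12 * (2 * C ^ K * 12 ^ t * R) * (C ^ k j * sqrt (real (e choose k j))) * Lam (n\<^sup>2) (K + k j) (leaf_density d c)
     = 2 * C ^ (K + k j) * 12 ^ Suc t * Lam (n\<^sup>2) (K + k j) (leaf_density d c) *
       (\<Prod>i\<in>J. sqrt (real (card (I i) choose k i)))"
    using J' by (simp add: R_def card_Ij power_add ac_simps)
  finally show ?case
    unfolding K(1) .
qed

theorem theorem4p9:
  fixes C p :: real and n d l K :: nat and T :: dtree
    and I :: "nat \<Rightarrow> nat set" and k :: "nat \<Rightarrow> nat"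
  assumes "C \<ge> 1" and "level12_const C"
    and "n \<ge> 1" and "d \<ge> 1" and "0 \<le> p" and "p \<le> 1"
    and "T \<in> trees_star0 n d p"
    and "l \<ge> 1"
    and "\<forall>i\<in>{1..l}. is_interval_nat (I i)"
    and "disjoint_family_on I {1..l}"
    and "(\<Union>i\<in>{1..l}. I i) = {1..d}"
    and "\<forall>i\<in>{1..l}. k i \<in> {1, 2}"
    and "K = (\<Sum>i=1..l. k i)"
  shows "fourier_norm n (tree_part T d (fam_joins (\<lambda>i. nsets (I i) (k i)) l))
    \<le> 2 * C ^ K * 12 ^ (l - 1) * Lam (n\<^sup>2) K p * (\<Prod>i=1..l. sqrt (real (card (I i) choose k i)))"
proof -
  \<comment> \<open>A constant polynomial is determined by its coefficient at the empty set.\<close>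
  define c where "c v = Poly_Mapping.lookup (leaf T v) {}" for v
  have T: "is_dtree n d T" "density d T = p" "\<forall>v\<in>strings d. leaf T v \<in> ml_const ` {-1, 0, 1}"
    using assms(7) by (auto simp: trees_star0_def)
  have leaf: "leaf T v = ml_const (c v) \<and> c v \<in> {-1, 0, 1}" if v: "v \<in> strings d" for v
  proof -
    obtain y where y: "leaf T v = ml_const y" "y \<in> {-1, 0, 1}"
      using bspec[OF T(3) v] by (rule imageE)
    then have "c v = y"
      by (simp add: c_def ml_const_def)
    with y show ?thesis by simp
  qed
  have val: "valid_queries n d (query T)"
    using T(1) unfolding is_dtree_def valid_queries_def queried_def[abs_def] by blast
  have "{v \<in> strings d. leaf T v \<noteq> 0} = {v \<in> strings d. c v \<noteq> 0}"
  proof -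
    have "leaf T v = 0 \<longleftrightarrow> c v = 0" if "v \<in> strings d" for v
      using leaf[OF that] by (metis c_def lookup_zero ml_const_def single_zero)
    then show ?thesis by blast
  qed
  then have p: "leaf_density d c = p"
    using T(2) by (simp add: density_def leaf_density_def)
  have "S \<subseteq> {1..d}" if "S \<in> blocks I k {1..l}" for S
    using that assms(11) by (simp add: blocks_def)
  then have "finite S" if "S \<in> blocks I k {1..l}" for S
    using that finite_subset[OF _ finite_atLeastAtMost] by blast
  then have fam: "fam_joins (\<lambda>i. nsets (I i) (k i)) l = blocks I k {1..l}"
    unfolding fam_joins_eq_blocks[OF assms(10)] by blast
  have part: "tree_part T d \<S> x = tree_sum (query T) d \<S> c x" for \<S> x
    unfolding tree_part_def tree_sum_def path_sum_def sum_distrib_left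
    by (subst sum.swap) (intro sum.cong refl, simp add: leaf queried_def)
  show ?thesis
  \<comment> \<open>Intervals may be empty here, which \<open>blocks_bound\<close> excludes. Since
    \<open>k i > 0\<close>, the family is then empty and a binomial coefficient is 0, so both sides
    vanish.\<close>
  proof (cases "\<exists>i\<in>{1..l}. I i = {}")
    case True
    then obtain i where i: "i \<in> {1..l}" "I i = {}" by blast
    have "k i > 0"
      using bspec[OF assms(12) i(1)] by auto
    then have empty: "blocks I k {1..l} = {}"
      using i unfolding blocks_def by fastforce
    have zero: "(\<Prod>i=1..l. sqrt (real (card (I i) choose k i))) = 0"
      using i \<open>k i > 0\<close> by (intro prod_zero bexI[of _ i]) (auto simp: binomial_eq_0)
    show ?thesis
      unfolding fam empty zero by (simp add: tree_part_def[abs_def])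
  next
    case False
    have "fourier_norm n (tree_sum (query T) d (blocks I k {1..l}) c) \<le>
      2 * C ^ (\<Sum>i=1..l. k i) * 12 ^ (l - 1) * Lam (n\<^sup>2) (\<Sum>i=1..l. k i) (leaf_density d c) *
      (\<Prod>i=1..l. sqrt (real (card (I i) choose k i)))"
      using assms False leaf val by (intro blocks_bound) auto
    then show ?thesis
      unfolding fam p assms(13) part[abs_def] .
  qed
qed

end
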